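(* Let $\mathcal A$ and $U$ be linear, uniformly closed, $C_{ub}$-invariant subsets of $L^1_{loc}(\mathbb J,X)$, let $\mathcal A$ satisfy $(L_U)$, and let $\phi\in L^\infty(\mathbb R,X)$. Assume that $\gamma_{\omega}\mathcal A\subset\mathcal A$, $\gamma_{-\omega}\mathcal A\subset\mathcal A$ and $(\gamma_{-\omega}\phi)|\,\mathbb J\in\mathcal MU$ for all $\omega\in sp_{\mathcal A}\phi$. Then $sp_{\mathcal A}\phi$ is perfect (i.e. closed without isolated points).
   Context: $X$ is a complex Banach space; $\mathbb J$ is an interval of the form $\mathbb R$, $(\alpha,\infty)$ or $[\alpha,\infty)$, $\alpha\in\mathbb R$. $\gamma_\omega(t)=e^{i\omega t}$. $C_{ub}$: bounded uniformly continuous functions. $f_a(t)=f(t+a)$, $\Delta_hf=f_h-f$. A class $\mathcal A\subset L^1_{loc}(\mathbb J,X)$ is uniformly closed if $(\phi_n)\subset\mathcal A$, $\phi_n\to\phi$ uniformly on $\mathbb J$ implies $\phi\in\mathcal A$; it is $C_{ub}$-invariant if for each $f\in C_{ub}(\mathbb R,X)$ with $f|\,\mathbb J\in\mathcal A$ one has $f_a|\,\mathbb J\in\mathcal A$ for all $a\in\mathbb R$. $(L_U)$ for $\mathcal A$: if $\psi\in U$ and $\Delta_h\psi\in\mathcal A$ for all $h>0$, then $\psi\in\mathcal A$. $\mathcal MU=\{f\in L^1_{loc}(\mathbb J,X):M_hf\in U\ \forall h>0\}$, $M_hf(t)=\frac1h\int_0^hf(t+s)\,ds$. $sp_{\mathcal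 A}\phi=\{\omega\in\mathbb R:$ for every $f\in L^1(\mathbb R,\mathbb C)$ with $(\phi*f)|\,\mathbb J\in\mathcal A$ one has $\hat f(\omega)=0\}$, where $\hat f(\omega)=\int_{\mathbb R}e^{-i\omega t}f(t)\,dt$. *)

theory Defs
  imports "HOL-Analysis.Analysis"
begin

class complex_banach = banach +
  fixes scaleC :: "complex \<Rightarrow> 'a \<Rightarrow> 'a"  (infixr "*\<^sub>C" 75)
  assumes scaleC_add_right: "c *\<^sub>C (x + y) = c *\<^sub>C x + c *\<^sub>C y"
    and scaleC_add_left: "(c + d) *\<^sub>C x = c *\<^sub>C x + d *\<^sub>C x"
    and scaleC_scaleC: "c *\<^sub>C d *\<^sub>C x = (c * d) *\<^sub>C x"
    and scaleC_of_real: "complex_of_real r *\<^sub>C x = r *\<^sub>R x"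
    and norm_scaleC: "norm (c *\<^sub>C x) = cmod c * norm x"

instantiation complex :: complex_banach
begin

definition scaleC_complex :: "complex \<Rightarrow> complex \<Rightarrow> complex"
  where "scaleC_complex c x = c * x"

instance
  by standard (simp_all add: scaleC_complex_def algebra_simps norm_mult scaleR_conv_of_real)

end

(* The library's Bochner integral is confined to second countable target spaces.
   The following is the same definition without that sort constraint.  An arbitrary X may
   be nonseparable; the existence of the simple approximants s then makes f almost
   everywhere separably valued.  The lemma below records the agreement with the library
   on second countable spaces. *)

definition has_bint :: "'m measure \<Rightarrow> ('m \<Rightarrow> 'a::real_normed_vector) \<Rightarrow> 'a \<Rightarrow> bool"
  where "has_bint M f x \<longleftrightarrow> f \<in> borel_measurable M \<and>
    (\<exists>s. (\<forall>i. Bochner_Integration.simple_bochner_integrable M (s i)) \<and>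
         (\<lambda>i. \<integral>\<^sup>+y. norm (f y - s i y) \<partial>M) \<longlonglongrightarrow> 0 \<and>
         (\<lambda>i::nat. Bochner_Integration.simple_bochner_integral M (s i)) \<longlonglongrightarrow> x)"

definition bintegrable :: "'m measure \<Rightarrow> ('m \<Rightarrow> 'a::real_normed_vector) \<Rightarrow> bool"
  where "bintegrable M f \<longleftrightarrow> (\<exists>x. has_bint M f x)"

definition bint :: "'m measure \<Rightarrow> ('m \<Rightarrow> 'a::real_normed_vector) \<Rightarrow> 'a"
  where "bint M f = (if bintegrable M f then THE x. has_bint M f x else 0)"

lemma has_bint_eq_has_bochner_integral:
  fixes f :: "'m \<Rightarrow> 'a::{real_normed_vector, second_countable_topology}"
  shows "has_bint M f x \<longleftrightarrow> has_bochner_integral M f x"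
  by (auto simp: has_bint_def has_bochner_integral.simps)

definition strongly_measurable :: "'m measure \<Rightarrow> ('m \<Rightarrow> 'a::real_normed_vector) \<Rightarrow> bool"
  where "strongly_measurable M f \<longleftrightarrow>
    (\<exists>s. (\<forall>i. simple_function M (s i)) \<and> (AE x in M. (\<lambda>i::nat. s i x) \<longlonglongrightarrow> f x))"

definition admissible_interval :: "real set \<Rightarrow> bool"
  where "admissible_interval J \<longleftrightarrow> J = UNIV \<or> (\<exists>\<alpha>. J = {\<alpha><..}) \<or> (\<exists>\<alpha>. J = {\<alpha>..})"

(* A function on J is represented extensionally, so that restrict f J is f|J.  Elements of
   L^1_loc(J,X) are functions, not classes modulo null sets; a set of classes corresponds to
   a set of functions that is closed under equality almost everywhere on J, and no such
   closure is assumed. *)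

definition L1loc :: "real set \<Rightarrow> (real \<Rightarrow> 'a::complex_banach) set"
  where "L1loc J = {f \<in> extensional J. \<forall>a b. {a..b} \<subseteq> J \<longrightarrow> bintegrable (lebesgue_on {a..b}) f}"

definition Linf :: "(real \<Rightarrow> 'a::complex_banach) set"
  where "Linf = {\<phi>. strongly_measurable lebesgue \<phi> \<and> (\<exists>C. AE t in lebesgue. norm (\<phi> t) \<le> C)}"

definition Cub :: "(real \<Rightarrow> 'a::complex_banach) set"
  where "Cub = {f. bounded (range f) \<and> uniformly_continuous_on UNIV f}"

definition linear_on_fun :: "real set \<Rightarrow> (real \<Rightarrow> 'a::complex_banach) set \<Rightarrow> bool"
  where "linear_on_fun J A \<longleftrightarrow> (\<lambda>t\<in>J. 0) \<in> A \<and>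
    (\<forall>f\<in>A. \<forall>g\<in>A. (\<lambda>t\<in>J. f t + g t) \<in> A) \<and> (\<forall>c. \<forall>f\<in>A. (\<lambda>t\<in>J. c *\<^sub>C f t) \<in> A)"

definition uniformly_closed :: "real set \<Rightarrow> (real \<Rightarrow> 'a::complex_banach) set \<Rightarrow> bool"
  where "uniformly_closed J A \<longleftrightarrow>
    (\<forall>F f. (\<forall>n::nat. F n \<in> A) \<and> f \<in> extensional J \<and> uniform_limit J F f sequentially \<longrightarrow> f \<in> A)"

definition Cub_invariant :: "real set \<Rightarrow> (real \<Rightarrow> 'a::complex_banach) set \<Rightarrow> bool"
  where "Cub_invariant J A \<longleftrightarrow>
    (\<forall>f\<in>Cub. restrict f J \<in> A \<longrightarrow> (\<forall>a. (\<lambda>t\<in>J. f (t + a)) \<in> A))"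

definition cond_L :: "real set \<Rightarrow> (real \<Rightarrow> 'a::complex_banach) set \<Rightarrow> (real \<Rightarrow> 'a) set \<Rightarrow> bool"
  where "cond_L J U A \<longleftrightarrow>
    (\<forall>\<psi>\<in>U. (\<forall>h>0. (\<lambda>t\<in>J. \<psi> (t + h) - \<psi> t) \<in> A) \<longrightarrow> \<psi> \<in> A)"

definition steklov_mean :: "real \<Rightarrow> (real \<Rightarrow> 'a::complex_banach) \<Rightarrow> real \<Rightarrow> 'a"
  where "steklov_mean h f t = (1 / h) *\<^sub>R bint (lebesgue_on {0..h}) (\<lambda>s. f (t + s))"

definition mean_class :: "real set \<Rightarrow> (real \<Rightarrow> 'a::complex_banach) set \<Rightarrow> (real \<Rightarrow> 'a) set"
  where "mean_class J U = {f \<in> L1loc J. \<forall>h>0. restrict (steklov_mean h f) J \<in> U}"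

definition character :: "real \<Rightarrow> real \<Rightarrow> complex"
  where "character \<omega> t = exp (\<i> * complex_of_real (\<omega> * t))"

definition fourier :: "(real \<Rightarrow> complex) \<Rightarrow> real \<Rightarrow> complex"
  where "fourier f \<omega> = (LINT t|lebesgue. exp (- \<i> * complex_of_real (\<omega> * t)) * f t)"

definition conv :: "(real \<Rightarrow> 'a::complex_banach) \<Rightarrow> (real \<Rightarrow> complex) \<Rightarrow> real \<Rightarrow> 'a"
  where "conv \<phi> f t = bint lebesgue (\<lambda>s. f s *\<^sub>C \<phi> (t - s))"

definition spectrum_mod ::
    "real set \<Rightarrow> (real \<Rightarrow> 'a::complex_banach) set \<Rightarrow> (real \<Rightarrow> 'a) \<Rightarrow> real set"
  where "spectrum_mod J A \<phi> = {\<omega>. \<forall>f. integrable lebesgue f \<and> restrict (conv \<phi> f) J \<in> A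
    \<longrightarrow> fourier f \<omega> = 0}"

end

theory Submission
  imports Defs "HOL-Probability.Sinc_Integral"
begin

text \<open>
  The spectrum is the set of common zeros of the Fourier transforms of those \<open>f\<close> in \<open>L\<^sup>1\<close> for
  which \<open>\<phi> * f\<close>, restricted to \<open>J\<close>, lies in \<open>A\<close>. Fourier transforms of integrable functions are
  continuous, so the spectrum is closed (\<open>closed_spectrum_mod\<close>); the work is to show that it has no
  isolated point.

  Suppose that \<open>w\<close> is isolated and move it to \<open>0\<close>: put
  \<open>T f = \<gamma>\<^bsub>-w\<^esub> (\<phi> * (\<gamma>\<^bsub>w\<^esub> f))\<close>. The operator \<open>T\<close> commutes with translations and maps \<open>L\<^sup>1\<close>
  boundedly into the bounded uniformly continuous functions, so the three closure properties of \<open>A\<close>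
  make \<open>D = {f. (T f)|J \<in> A}\<close> a closed translation-invariant subspace of \<open>L\<^sup>1\<close>, hence a closed ideal
  for convolution, and \<open>\<gamma>\<^bsub>-w\<^esub> A \<subseteq> A\<close> says that every \<open>u \<noteq> 0\<close> near \<open>0\<close> is a point at which the
  Fourier transform of some element of \<open>D\<close> does not vanish. Let \<open>k\<close> be the Fejer kernel whose
  Fourier transform is, up to a constant factor, a tent centred at \<open>0\<close> with small support. The condition
  \<open>cond_L\<close> is applied to \<open>\<psi> = (T k)|J\<close>.

  All differences of \<open>\<psi>\<close> are in \<open>A\<close> (\<open>difference_tent_kernel_mem\<close>). This is spectral synthesis at
  a single point, done with tents only. A tent is a sum of three tents of half its width
  (\<open>tent_kernel_refine\<close>). Wiener's local inversion puts every narrow tent near a point where some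
  element of \<open>D\<close> has nonzero transform into \<open>D\<close>, and refinement extends this to all tents supported in
  the set of such points. Refining repeatedly towards \<open>0\<close> shows that, modulo \<open>D\<close>, the tent of half-width
  \<open>a\<close> at \<open>0\<close> equals the tent of half-width \<open>a / 2^n\<close>; its kernel is so flat that a translation by \<open>h\<close>
  changes it by an amount that tends to \<open>0\<close> in \<open>L\<^sup>1\<close>.

  The function \<open>\<psi>\<close> itself is in \<open>U\<close> (\<open>demodulated_conv_mem_if_steklov_means_mem\<close>): the Steklov means of
  \<open>\<gamma>\<^bsub>-w\<^esub> \<phi>\<close> are \<open>T f\<close> for normalised indicators \<open>f\<close> of the intervals \<open>[-h, 0]\<close>, and translates of
  these span a dense subspace of \<open>L\<^sup>1\<close>.

  Therefore \<open>\<psi> \<in> A\<close>, and since \<open>\<gamma>\<^bsub>w\<^esub> A \<subseteq> A\<close> the function \<open>\<gamma>\<^bsub>w\<^esub> k\<close> is one of those whose Fourier transform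
  must vanish at \<open>w\<close>. But its value there is \<open>\<integral> k > 0\<close>.
\<close>

section \<open>Closed subspaces of L1 and continuity of translation\<close>

definition L1_norm :: "(real \<Rightarrow> complex) \<Rightarrow> real"
  where "L1_norm f = (LINT x|lborel. norm (f x))"

lemma L1_norm_nonneg [simp]: "0 \<le> L1_norm f"
  by (simp add: L1_norm_def)

lemma L1_norm_add_le:
  assumes "integrable lborel f" "integrable lborel g"
  shows "L1_norm (\<lambda>x. f x + g x) \<le> L1_norm f + L1_norm g"
proof -
  have "L1_norm (\<lambda>x. f x + g x) \<le> (LINT x|lborel. norm (f x) + norm (g x))"
    unfolding L1_norm_def using assms by (intro integral_mono norm_triangle_ineq) auto
  then show ?thesis using assms by (simp add: L1_norm_def)
qed

lemma L1_norm_cmult: "L1_norm (\<lambda>x. c * f x) = norm c * L1_norm f"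
  by (simp add: L1_norm_def norm_mult)

lemma L1_norm_minus_commute: "L1_norm (\<lambda>x. f x - g x) = L1_norm (\<lambda>x. g x - f x)"
  by (simp add: L1_norm_def norm_minus_commute)

lemma L1_norm_triangle:
  assumes "integrable lborel f" "integrable lborel g" "integrable lborel h"
  shows "L1_norm (\<lambda>x. f x - h x) \<le> L1_norm (\<lambda>x. f x - g x) + L1_norm (\<lambda>x. g x - h x)"
  using L1_norm_add_le[of "\<lambda>x. f x - g x" "\<lambda>x. g x - h x"] assms by simp

lemma L1_norm_tendsto_zeroI:
  assumes "\<And>a. L1_norm (F a) \<le> G a" "(G \<longlongrightarrow> 0) A"
  shows "((\<lambda>a. L1_norm (F a)) \<longlongrightarrow> 0) A"
  by (rule Lim_null_comparison[OF always_eventually assms(2)]) (simp add: assms(1))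

lemma integrable_indicator_Icc_complex:
  "integrable lborel (indicator {a..b} :: real \<Rightarrow> complex)"
proof -
  have "integrable lborel (\<lambda>x. complex_of_real (indicator {a..b::real} x))"
    by (rule integrable_of_real) (simp add: integrable_indicator_iff emeasure_lborel_Icc_eq)
  also have "(\<lambda>x. complex_of_real (indicator {a..b::real} x)) = indicator {a..b}"
    by (auto simp: indicator_def)
  finally show ?thesis .
qed

lemma integrable_translate:
  fixes f :: "real \<Rightarrow> 'b::{banach, second_countable_topology}"
  assumes "integrable lborel f" shows "integrable lborel (\<lambda>x. f (x + a))"
  using lborel_integrable_real_affine[OF assms, of 1 a] by (simp add: add.commute)

lemma integral_translate:
  fixes f :: "real \<Rightarrow> 'b::{banach, second_countable_topology}"
  shows "(LINT x|lborel. f (x + a)) = (LINT x|lborel. f x)"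
  using lborel_integral_real_affine[of 1 f a] by (simp add: add.commute)

lemma L1_norm_translate: "L1_norm (\<lambda>x. f (x + a)) = L1_norm f"
  unfolding L1_norm_def by (rule integral_translate)

text \<open>
  Elements are functions, not classes: the closure axiom also makes such a set closed under
  modification on a null set.
\<close>
locale L1_closed_subspace =
  fixes D :: "(real \<Rightarrow> complex) set"
  assumes mem_integrable: "f \<in> D \<Longrightarrow> integrable lborel f"
    and zero_mem: "(\<lambda>x. 0) \<in> D"
    and add_mem: "f \<in> D \<Longrightarrow> g \<in> D \<Longrightarrow> (\<lambda>x. f x + g x) \<in> D"
    and cmult_mem: "f \<in> D \<Longrightarrow> (\<lambda>x. c * f x) \<in> D"
    and closure_mem: "integrable lborel f \<Longrightarrow>
      (\<And>e. e > 0 \<Longrightarrow> \<exists>g\<in>D. L1_norm (\<lambda>x. f x - g x) < e) \<Longrightarrow> f \<in> D"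
begin

lemma diff_mem: "f \<in> D \<Longrightarrow> g \<in> D \<Longrightarrow> (\<lambda>x. f x - g x) \<in> D"
  using add_mem[of f "\<lambda>x. - 1 * g x"] cmult_mem[of g "- 1"] by simp

lemma AE_mem:
  assumes f: "f \<in> D" and g: "g \<in> borel_measurable lborel" and ae: "AE x in lborel. f x = g x"
  shows "g \<in> D"
proof (rule closure_mem)
  show "integrable lborel g"
    using mem_integrable[OF f] integrable_cong_AE[of f lborel g] g ae by auto
  have "AE x in lborel. norm (g x - f x) = 0" using ae by eventually_elim simp
  then have "L1_norm (\<lambda>x. g x - f x) = 0" unfolding L1_norm_def
    using integral_cong_AE[of "\<lambda>x. norm (g x - f x)" lborel "\<lambda>x. 0"] g mem_integrable[OF f] by simp
  with f show "\<exists>i\<in>D. L1_norm (\<lambda>x. g x - i x) < e" if "e > 0" for e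
    using that by force
qed

lemma dominated_limit_mem:
  assumes g: "\<And>n::nat. g n \<in> D" and lim: "\<And>x. (\<lambda>n. g n x) \<longlonglongrightarrow> f x"
    and w: "integrable lborel w" and bd: "\<And>n x. norm (g n x) \<le> w x"
  shows "f \<in> D"
proof (rule closure_mem)
  have gm[measurable]: "g n \<in> borel_measurable lborel" for n using mem_integrable[OF g] by simp
  have fm[measurable]: "f \<in> borel_measurable lborel"
    by (rule borel_measurable_LIMSEQ_metric[OF gm]) (rule lim)
  show fi: "integrable lborel f"
    by (rule integrable_dominated_convergence[where w=w and s=g]) (use lim w bd in auto)
  have fb: "norm (f x) \<le> w x" for x
    by (rule LIMSEQ_le_const2[OF tendsto_norm[OF lim]]) (use bd in auto)
  have "(\<lambda>n. LINT x|lborel. norm (f x - g n x)) \<longlonglongrightarrow> (LINT x|(lborel::real measure). (0::real))"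
  proof (rule integral_dominated_convergence[where w="\<lambda>x. 2 * w x"])
    show "AE x in lborel. (\<lambda>n. norm (f x - g n x)) \<longlonglongrightarrow> 0"
    proof (rule AE_I2)
      fix x show "(\<lambda>n. norm (f x - g n x)) \<longlonglongrightarrow> 0"
        using tendsto_norm[OF tendsto_diff[OF tendsto_const[of "f x"] lim[of x]]] by simp
    qed
    show "AE x in lborel. norm (norm (f x - g n x)) \<le> 2 * w x" for n
    proof (rule AE_I2)
      fix x show "norm (norm (f x - g n x)) \<le> 2 * w x"
        using norm_triangle_ineq4[of "f x" "g n x"] fb[of x] bd[of n x] by simp
    qed
  qed (use w in auto)
  then have "(\<lambda>n. L1_norm (\<lambda>x. f x - g n x)) \<longlonglongrightarrow> 0" by (simp add: L1_norm_def)
  then have "\<exists>n. L1_norm (\<lambda>x. f x - g n x) < e" if "e > 0" for e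
    using order_tendstoD(2)[OF _ that] eventually_happens by force
  then show "\<exists>i\<in>D. L1_norm (\<lambda>x. f x - i x) < e" if "e > 0" for e using g that by blast
qed

lemma sum_mem: "finite S \<Longrightarrow> (\<And>i. i \<in> S \<Longrightarrow> f i \<in> D) \<Longrightarrow> (\<lambda>x. \<Sum>i\<in>S. f i x) \<in> D"
  by (induction S rule: finite_induct) (auto intro: zero_mem add_mem)

text \<open>
  Density of the step functions. The Borel sets that work, cut down to a bounded interval, form a
  Dynkin system that contains the intervals; dominated convergence removes the cut-off, and integrable
  functions are limits of simple functions.
\<close>
lemma everything_if_interval_indicators:
  assumes ind: "\<And>a b. a \<le> b \<Longrightarrow> indicator {a..b} \<in> D" and f: "integrable lborel f"
  shows "f \<in> D"
proof -
  have box: "(indicator {a..b} :: real \<Rightarrow> complex) \<in> D" for a b :: real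
  proof (cases "a \<le> b")
    case False
    then have "(indicator {a..b} :: real \<Rightarrow> complex) = (\<lambda>x. 0)" by (auto simp: indicator_def)
    then show ?thesis using zero_mem by simp
  qed (rule ind)
  have bounded_borel: "(indicator (B \<inter> {-r..r}) :: real \<Rightarrow> complex) \<in> D"
    if "B \<in> sets borel" for B and r :: real
  proof -
    from that show ?thesis
    proof (induction rule: borel_set_induct)
      case (interval a b)
      then show ?case using box[of "max a (-r)" "min b r"] by simp
    next
      case empty show ?case using zero_mem by simp
    next
      case (compl A)
      have "(\<lambda>x. indicator {-r..r} x - indicator (A \<inter> {-r..r}) x) \<in> D"
        by (rule diff_mem[OF box compl(2)])
      moreover have "(\<lambda>x. indicator {-r..r} x - indicator (A \<inter> {-r..r}) x)
          = (indicator ((- A) \<inter> {-r..r}) :: real \<Rightarrow> complex)"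
        by (auto simp: indicator_def fun_eq_iff)
      ultimately show ?case by simp
    next
      case (union A)
      let ?g = "\<lambda>n x. \<Sum>i<n. indicator (A i \<inter> {-r..r}) x :: complex"
      have un: "?g n x = indicator ((\<Union>i<n. A i) \<inter> {-r..r}) x" for n x
      proof -
        have "disjoint_family_on (\<lambda>i. A i \<inter> {-r..r}) {..<n}"
          using union by (auto simp: disjoint_family_on_def)
        then have "indicator (\<Union>i<n. A i \<inter> {-r..r}) x = ?g n x"
          by (intro indicator_UN_disjoint) auto
        then show ?thesis by (simp only: UN_simps(4))
      qed
      show ?case
      proof (rule dominated_limit_mem)
        show "?g n \<in> D" for n by (rule sum_mem) (use union in auto)
        show "(\<lambda>n. ?g n x) \<longlonglongrightarrow> indicator (\<Union> (range A) \<inter> {-r..r}) x" for x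
        proof (cases "x \<in> \<Union> (range A)")
          case True
          then obtain i where i: "x \<in> A i" by auto
          show ?thesis
          proof (rule tendsto_eventually)
            show "\<forall>\<^sub>F n in sequentially. ?g n x = indicator (\<Union> (range A) \<inter> {-r..r}) x"
              using eventually_gt_at_top[of i]
            proof eventually_elim
              case (elim n)
              then have "x \<in> (\<Union>i<n. A i)" using i by auto
              with True have "indicator ((\<Union>i<n. A i) \<inter> {-r..r}) x = (indicator (\<Union> (range A) \<inter> {-r..r}) x :: complex)"
                by (auto simp: indicator_def)
              then show ?case by (simp only: un)
            qed
          qed
        next
          case False
          then show ?thesis by simp
        qed
        show "integrable lborel (indicator {-r..r} :: real \<Rightarrow> real)"
          by (simp add: integrable_indicator_iff emeasure_lborel_Icc_eq)
        show "norm (?g n x) \<le> indicator {-r..r} x" for n x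
          unfolding un by (auto simp: indicator_def)
      qed
    qed
  qed
  from f show ?thesis
  proof (induction rule: integrable_induct)
    case (base B c)
    have Bm: "B \<in> sets borel" using base by simp
    have "(indicator B :: real \<Rightarrow> complex) \<in> D"
    proof (rule dominated_limit_mem)
      show "(indicator (B \<inter> {-real n..real n}) :: real \<Rightarrow> complex) \<in> D" for n
        by (rule bounded_borel[OF Bm])
      show "(\<lambda>n. indicator (B \<inter> {-real n..real n}) x :: complex) \<longlonglongrightarrow> indicator B x" for x
      proof (rule tendsto_eventually)
        show "\<forall>\<^sub>F n in sequentially. (indicator (B \<inter> {-real n..real n}) x :: complex) = indicator B x"
          using eventually_ge_at_top[of "nat \<lceil>\<bar>x\<bar>\<rceil>"]
        proof eventually_elim
          case (elim n)
          then have "\<bar>x\<bar> \<le> real n" by linarith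
          then have "x \<in> {-real n..real n}" by auto
          then show ?case by (auto simp: indicator_def)
        qed
      qed
      show "integrable lborel (indicator B :: real \<Rightarrow> real)"
        using base by (simp add: integrable_indicator_iff)
      show "norm (indicator (B \<inter> {-real n..real n}) x :: complex) \<le> indicator B x" for n x
        by (auto simp: indicator_def)
    qed
    from cmult_mem[OF this, of c] show ?case
      by (rule back_subst[where P="\<lambda>f. f \<in> D"]) (auto simp: indicator_def)
  next
    case (add f g) then show ?case by (simp add: add_mem)
  next
    case (lim f s)
    show ?case
    proof (rule dominated_limit_mem)
      show "s i \<in> D" for i by (rule lim)
      show "(\<lambda>n. s n x) \<longlonglongrightarrow> f x" for x using lim by simp
      show "integrable lborel (\<lambda>x. 2 * norm (f x))" using lim by simp
      show "norm (s n x) \<le> 2 * norm (f x)" for n x using lim by simp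
    qed
  qed
qed

end

text \<open>
  The functions with a continuous orbit form a closed subspace, which contains the indicators of
  intervals because these change only near the two end points.
\<close>
lemma L1_translation_continuous:
  assumes f: "integrable lborel f"
  shows "((\<lambda>a. L1_norm (\<lambda>x. f (x + a) - f x)) \<longlongrightarrow> 0) (at 0)"
proof -
  define D where "D = {f. integrable lborel f \<and> ((\<lambda>a. L1_norm (\<lambda>x. f (x + a) - f x)) \<longlongrightarrow> 0) (at 0)}"
  interpret D: L1_closed_subspace D
  proof
    show "(\<lambda>x. f x + g x) \<in> D" if "f \<in> D" "g \<in> D" for f g
      unfolding D_def
    proof (intro CollectI conjI)
      show "integrable lborel (\<lambda>x. f x + g x)" using that by (simp add: D_def)
      have le: "L1_norm (\<lambda>x. f (x + a) + g (x + a) - (f x + g x))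
          \<le> L1_norm (\<lambda>x. f (x + a) - f x) + L1_norm (\<lambda>x. g (x + a) - g x)" for a
        using that L1_norm_add_le[of "\<lambda>x. f (x + a) - f x" "\<lambda>x. g (x + a) - g x"]
        by (simp add: D_def integrable_translate algebra_simps)
      have "((\<lambda>a. L1_norm (\<lambda>x. f (x + a) - f x) + L1_norm (\<lambda>x. g (x + a) - g x)) \<longlongrightarrow> 0 + 0) (at 0)"
        using that by (intro tendsto_add) (auto simp: D_def)
      then show "((\<lambda>a. L1_norm (\<lambda>x. f (x + a) + g (x + a) - (f x + g x))) \<longlongrightarrow> 0) (at 0)"
        by (intro L1_norm_tendsto_zeroI[OF le]) simp
    qed
    show "(\<lambda>x. c * f x) \<in> D" if "f \<in> D" for f c
    proof -
      have "L1_norm (\<lambda>x. c * f (x + a) - c * f x) = norm c * L1_norm (\<lambda>x. f (x + a) - f x)" for a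
        unfolding right_diff_distrib[symmetric] by (rule L1_norm_cmult)
      then show ?thesis
        using that tendsto_mult_right_zero[of "\<lambda>a. L1_norm (\<lambda>x. f (x + a) - f x)" "at 0" "norm c"]
        by (simp add: D_def)
    qed
    show "f \<in> D" if f: "integrable lborel f"
      and ex: "\<And>e. e > 0 \<Longrightarrow> \<exists>g\<in>D. L1_norm (\<lambda>x. f x - g x) < e" for f
      unfolding D_def
    proof (intro CollectI conjI order_tendstoI)
      fix e :: real assume "0 < e"
      then obtain g where g: "g \<in> D" "L1_norm (\<lambda>x. f x - g x) < e/3" using ex[of "e/3"] by auto
      then have gi: "integrable lborel g" by (simp add: D_def)
      have "\<forall>\<^sub>F a in at 0. L1_norm (\<lambda>x. g (x + a) - g x) < e/3"
        using g(1) \<open>0 < e\<close> unfolding D_def by (intro order_tendstoD(2)[where y=0]) simp_all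
      then show "\<forall>\<^sub>F a in at 0. L1_norm (\<lambda>x. f (x + a) - f x) < e"
      proof eventually_elim
        case (elim a)
        have "L1_norm (\<lambda>x. f (x + a) - f x) \<le>
           L1_norm (\<lambda>x. f (x + a) - g (x + a)) + L1_norm (\<lambda>x. g (x + a) - f x)"
          by (intro L1_norm_triangle integrable_translate f gi)
        also have "L1_norm (\<lambda>x. g (x + a) - f x) \<le>
           L1_norm (\<lambda>x. g (x + a) - g x) + L1_norm (\<lambda>x. g x - f x)"
          by (intro L1_norm_triangle integrable_translate f gi)
        also have "L1_norm (\<lambda>x. f (x + a) - g (x + a)) = L1_norm (\<lambda>x. f x - g x)"
          by (rule L1_norm_translate[of "\<lambda>x. f x - g x"])
        finally show ?case
          using g(2) elim L1_norm_minus_commute[of f g] by simp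
      qed
    qed (use f in \<open>auto intro!: always_eventually less_le_trans[OF _ L1_norm_nonneg]\<close>)
  qed (auto simp: D_def L1_norm_def)
  have "f \<in> D"
  proof (rule D.everything_if_interval_indicators[OF _ f])
    fix a b :: real assume "a \<le> b"
    have le: "L1_norm (\<lambda>x. indicator {a..b} (x + h) - indicator {a..b} x) \<le> 4 * \<bar>h\<bar>" for h
    proof -
      \<comment> \<open>The difference lives within distance \<open>\<bar>h\<bar>\<close> of the two end points.\<close>
      let ?b = "\<lambda>x. indicator {a-\<bar>h\<bar>..a+\<bar>h\<bar>} x + indicator {b-\<bar>h\<bar>..b+\<bar>h\<bar>} x :: real"
      have "L1_norm (\<lambda>x. indicator {a..b} (x + h) - indicator {a..b} x) \<le> (LINT x|lborel. ?b x)"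
        unfolding L1_norm_def
      proof (rule integral_mono)
        have "integrable lborel (\<lambda>x. indicator {a..b} (x + h) :: complex)"
          by (rule integrable_translate) (rule integrable_indicator_Icc_complex)
        then show "integrable lborel (\<lambda>x. norm (indicator {a..b} (x + h) - indicator {a..b} x :: complex))"
          by (intro integrable_norm Bochner_Integration.integrable_diff integrable_indicator_Icc_complex)
        show "norm (indicator {a..b} (x + h) - indicator {a..b} x :: complex) \<le> ?b x" for x
          by (auto simp: indicator_def)
      qed simp
      then show ?thesis by simp
    qed
    have "((\<lambda>h::real. 4 * \<bar>h\<bar>) \<longlongrightarrow> 0) (at 0)" by (auto intro!: tendsto_eq_intros)
    then have "((\<lambda>h. L1_norm (\<lambda>x. indicator {a..b} (x + h) - indicator {a..b} x)) \<longlongrightarrow> 0) (at 0)"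
      by (rule L1_norm_tendsto_zeroI[OF le])
    then show "indicator {a..b} \<in> D" by (simp add: D_def integrable_indicator_Icc_complex)
  qed
  then show ?thesis
by (simp add: D_def)
qed

section \<open>Convolution and closed ideals\<close>

text \<open>
  Fubini's theorem together with Minkowski's inequality for the \<open>L\<^sup>1\<close> norm of an integral.
\<close>
lemma pair_integral_bounds:
  fixes F :: "real \<Rightarrow> real \<Rightarrow> complex"
  assumes F: "integrable (lborel \<Otimes>\<^sub>M lborel) (\<lambda>(s, x). F s x)"
  shows "integrable lborel (\<lambda>x. LINT s|lborel. F s x)"
    and "integrable lborel (\<lambda>s. L1_norm (F s))"
    and "L1_norm (\<lambda>x. LINT s|lborel. F s x) \<le> (LINT s|lborel. L1_norm (F s))"
    and "AE x in lborel. integrable lborel (\<lambda>s. F s x)"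
proof -
  have nF: "integrable (lborel \<Otimes>\<^sub>M lborel) (\<lambda>(s, x). norm (F s x))"
    using integrable_norm[OF F] by (simp add: case_prod_beta')
  show 1: "integrable lborel (\<lambda>x. LINT s|lborel. F s x)"
    by (rule lborel_pair.integrable_snd[OF F])
  show 2: "integrable lborel (\<lambda>s. L1_norm (F s))"
    unfolding L1_norm_def by (rule lborel_pair.integrable_fst[OF nF])
  have "L1_norm (\<lambda>x. LINT s|lborel. F s x) \<le> (LINT x|lborel. LINT s|lborel. norm (F s x))"
    unfolding L1_norm_def
    by (rule integral_mono[OF integrable_norm[OF 1] lborel_pair.integrable_snd[OF nF]]) simp
  also have "\<dots> = (LINT s|lborel. L1_norm (F s))"
    unfolding L1_norm_def by (rule lborel_pair.Fubini_integral[OF nF])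
  finally show "L1_norm (\<lambda>x. LINT s|lborel. F s x) \<le> (LINT s|lborel. L1_norm (F s))" .
  have "integrable (lborel \<Otimes>\<^sub>M lborel) (\<lambda>(x, s). F s x)"
    using lborel_pair.integrable_product_swap[OF F] by (simp add: case_prod_beta')
  from lborel_pair.AE_integrable_fst[OF this]
  show "AE x in lborel. integrable lborel (\<lambda>s. F s x)" by simp
qed

definition convolve :: "(real \<Rightarrow> complex) \<Rightarrow> (real \<Rightarrow> complex) \<Rightarrow> real \<Rightarrow> complex"
  where "convolve f g x = (LINT s|lborel. f (x - s) * g s)"

lemma convolve_pair_integrable:
  fixes f g :: "real \<Rightarrow> complex"
  assumes f: "integrable lborel f" and g: "integrable lborel g"
  shows "integrable (lborel \<Otimes>\<^sub>M lborel) (\<lambda>(s, x). f (x - s) * g s)"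
proof (rule lborel_pair.Fubini_integrable)
  have [measurable]: "f \<in> borel_measurable borel" "g \<in> borel_measurable borel" using f g by auto
  show "(\<lambda>(s, x). f (x - s) * g s) \<in> borel_measurable (lborel \<Otimes>\<^sub>M lborel)" by measurable
  have "(LINT x|lborel. norm (f (x - s) * g s)) = norm (g s) * L1_norm f" for s
    using L1_norm_translate[of f "-s"] by (simp add: norm_mult L1_norm_def)
  then show "integrable lborel (\<lambda>s. LINT x|lborel. norm (case (s, x) of (s, x) \<Rightarrow> f (x - s) * g s))"
    using g by simp
  show "AE s in lborel. integrable lborel (\<lambda>x. case (s, x) of (s, x) \<Rightarrow> f (x - s) * g s)"
    using integrable_translate[OF f, of "- s" for s] by simp
qed

lemma convolve_minus_pair_integrable:
  fixes f g :: "real \<Rightarrow> complex"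
  assumes f: "integrable lborel f" and g: "integrable lborel g"
  shows "integrable (lborel \<Otimes>\<^sub>M lborel) (\<lambda>(s, x). (f (x - s) - f x) * g s)"
proof -
  have "integrable (lborel \<Otimes>\<^sub>M lborel) (\<lambda>(s, x). f x * g s)"
  proof (rule lborel_pair.Fubini_integrable)
    have [measurable]: "f \<in> borel_measurable borel" "g \<in> borel_measurable borel" using f g by auto
    show "(\<lambda>(s, x). f x * g s) \<in> borel_measurable (lborel \<Otimes>\<^sub>M lborel)" by measurable
  qed (use f g in \<open>auto simp: norm_mult\<close>)
  from Bochner_Integration.integrable_diff[OF convolve_pair_integrable[OF f g] this]
  show ?thesis by (simp add: case_prod_beta' left_diff_distrib)
qed

lemma
  fixes f g :: "real \<Rightarrow> complex"
  assumes f: "integrable lborel f" and g: "integrable lborel g"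
  shows integrable_convolve: "integrable lborel (convolve f g)"
    and L1_norm_convolve_le: "L1_norm (convolve f g) \<le> L1_norm f * L1_norm g"
    and convolve_AE_integrable: "AE x in lborel. integrable lborel (\<lambda>s. f (x - s) * g s)"
    and integral_convolve: "(LINT x|lborel. convolve f g x) = (LINT x|lborel. f x) * (LINT x|lborel. g x)"
proof -
  note F = convolve_pair_integrable[OF f g]
  have convolve: "convolve f g = (\<lambda>x. LINT s|lborel. f (x - s) * g s)" by (simp add: convolve_def fun_eq_iff)
  show "integrable lborel (convolve f g)"
    unfolding convolve by (rule pair_integral_bounds[OF F])
  have "L1_norm (\<lambda>x. f (x - s) * g s) = L1_norm f * norm (g s)" for s
    using L1_norm_translate[of f "-s"] L1_norm_cmult[of "g s" "\<lambda>x. f (x - s)"] by (simp add: mult.commute)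
  with pair_integral_bounds(3)[OF F] show "L1_norm (convolve f g) \<le> L1_norm f * L1_norm g"
    by (simp add: convolve L1_norm_def[of g])
  show "AE x in lborel. integrable lborel (\<lambda>s. f (x - s) * g s)"
    by (rule pair_integral_bounds[OF F])
  have "(LINT x|lborel. f (x - s) * g s) = (LINT x|lborel. f x) * g s" for s
    using integral_translate[of f "-s"] by (simp only: integral_mult_left_zero) simp
  with lborel_pair.Fubini_integral[OF F]
  show "(LINT x|lborel. convolve f g x) = (LINT x|lborel. f x) * (LINT x|lborel. g x)"
    by (simp only: convolve integral_mult_right_zero)
qed

text \<open>
  How far \<open>f\<close> is from being multiplied by the scalar \<open>\<integral> g\<close> under convolution with \<open>g\<close>. It serves twice: for short
  indicators \<open>g\<close>, and for a widely dilated kernel \<open>f\<close>.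
\<close>
lemma L1_norm_convolve_minus_le:
  assumes f: "integrable lborel f" and g: "integrable lborel g"
  shows "L1_norm (\<lambda>x. convolve f g x - (LINT s|lborel. g s) * f x)
      \<le> (LINT s|lborel. L1_norm (\<lambda>x. f (x - s) - f x) * norm (g s))"
    and "integrable lborel (\<lambda>s. L1_norm (\<lambda>x. f (x - s) - f x) * norm (g s))"
proof -
  note F = convolve_minus_pair_integrable[OF f g]
  have eq: "L1_norm (\<lambda>x. (f (x - s) - f x) * g s) = L1_norm (\<lambda>x. f (x - s) - f x) * norm (g s)" for s
    using L1_norm_cmult[of "g s" "\<lambda>x. f (x - s) - f x"] by (simp add: mult.commute)
  have "AE x in lborel. convolve f g x - (LINT s|lborel. g s) * f x = (LINT s|lborel. (f (x - s) - f x) * g s)"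
    using convolve_AE_integrable[OF f g]
  proof eventually_elim
    case (elim x)
    have "(LINT s|lborel. f x * g s) = (LINT s|lborel. g s) * f x" by (simp add: mult.commute)
    moreover have "(LINT s|lborel. (f (x - s) - f x) * g s)
        = convolve f g x - (LINT s|lborel. f x * g s)"
      unfolding convolve_def left_diff_distrib
      using elim g by (intro Bochner_Integration.integral_diff) auto
    ultimately show ?case by simp
  qed
  then have "L1_norm (\<lambda>x. convolve f g x - (LINT s|lborel. g s) * f x)
      = L1_norm (\<lambda>x. LINT s|lborel. (f (x - s) - f x) * g s)"
    unfolding L1_norm_def
    using integrable_convolve[OF f g] f pair_integral_bounds(1)[OF F]
    by (intro integral_cong_AE) auto
  with pair_integral_bounds(3)[OF F] eq
  show "L1_norm (\<lambda>x. convolve f g x - (LINT s|lborel. g s) * f x)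
      \<le> (LINT s|lborel. L1_norm (\<lambda>x. f (x - s) - f x) * norm (g s))" by simp
  from pair_integral_bounds(2)[OF F] eq
  show "integrable lborel (\<lambda>s. L1_norm (\<lambda>x. f (x - s) - f x) * norm (g s))" by simp
qed

lemma convolve_add_AE:
  assumes "integrable lborel f" "integrable lborel g" "integrable lborel h"
  shows "AE x in lborel. convolve f (\<lambda>s. g s + h s) x = convolve f g x + convolve f h x"
  using convolve_AE_integrable[OF assms(1,2)] convolve_AE_integrable[OF assms(1,3)]
  by eventually_elim (simp add: convolve_def distrib_left)

lemma convolve_cmult: "convolve f (\<lambda>s. c * g s) x = c * convolve f g x"
proof -
  have "convolve f (\<lambda>s. c * g s) x = (LINT s|lborel. c * (f (x - s) * g s))"
    unfolding convolve_def by (rule Bochner_Integration.integral_cong) auto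
  then show ?thesis by (simp add: convolve_def)
qed

lemma convolve_translate_right: "convolve f (\<lambda>s. g (s + a)) x = convolve f g (x + a)"
  unfolding convolve_def using integral_translate[of "\<lambda>s. f (x + a - s) * g s" a]
  by (simp add: algebra_simps)

lemma convolve_commute: "convolve f g x = convolve g f x"
  unfolding convolve_def using lborel_integral_real_affine[of "-1" "\<lambda>s. f (x - s) * g s" x]
  by (simp add: mult.commute)

lemma L1_norm_AE_cong:
  assumes "f \<in> borel_measurable lborel" "g \<in> borel_measurable lborel" "AE x in lborel. f x = g x"
  shows "L1_norm f = L1_norm g"
  unfolding L1_norm_def using assms by (intro integral_cong_AE) auto

lemma L1_norm_convolve_diff_right:
  assumes "integrable lborel f" "integrable lborel g" "integrable lborel h"
  shows "L1_norm (\<lambda>x. convolve f g x - convolve f h x) \<le> L1_norm f * L1_norm (\<lambda>x. g x - h x)"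
proof -
  have "AE x in lborel. convolve f g x - convolve f h x = convolve f (\<lambda>s. g s - h s) x"
    using convolve_AE_integrable[OF assms(1,2)] convolve_AE_integrable[OF assms(1,3)]
    by eventually_elim (simp add: convolve_def right_diff_distrib)
  then have "L1_norm (\<lambda>x. convolve f g x - convolve f h x) = L1_norm (convolve f (\<lambda>s. g s - h s))"
    by (intro L1_norm_AE_cong borel_measurable_integrable Bochner_Integration.integrable_diff
        integrable_convolve assms)
  also have "\<dots> \<le> L1_norm f * L1_norm (\<lambda>x. g x - h x)"
    using assms by (intro L1_norm_convolve_le) auto
  finally show ?thesis .
qed

lemma L1_norm_convolve_diff_left:
  assumes "integrable lborel f" "integrable lborel g" "integrable lborel h"
  shows "L1_norm (\<lambda>x. convolve f h x - convolve g h x) \<le> L1_norm (\<lambda>x. f x - g x) * L1_norm h"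
  using L1_norm_convolve_diff_right[OF assms(3,1,2)]
  by (simp add: convolve_commute[of _ h] mult.commute)

locale L1_closed_ideal = L1_closed_subspace +
  assumes translate_mem: "f \<in> D \<Longrightarrow> (\<lambda>x. f (x + a)) \<in> D"
begin

text \<open>
  On a short interval of length \<open>h\<close> the convolution with the indicator is nearly \<open>h f\<close>, with error at most \<open>h w\<close>.
  Doubling the interval replaces the approximant by the sum of itself and a translate and doubles the
  error, so the error stays proportional to the length while \<open>w\<close> is governed by the shortest interval alone.
\<close>
lemma convolve_indicator_approx:
  assumes f: "f \<in> D" and h: "0 < h"
    and w: "\<And>s. 0 \<le> s \<Longrightarrow> s \<le> h \<Longrightarrow> L1_norm (\<lambda>x. f (x - s) - f x) \<le> w"
  shows "\<exists>i\<in>D. L1_norm (\<lambda>x. convolve f (indicator {0..2 ^ n * h}) x - i x) \<le> 2 ^ n * h * w"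
proof (induction n)
  case 0
  note fi = mem_integrable[OF f]
  have I: "(LINT s|lborel. indicator {0..h} s) = (complex_of_real h)"
  proof -
    have "(LINT s|lborel. complex_of_real (indicator {0..h} s)) = complex_of_real h"
      using h by (simp del: of_real_indicator)
    moreover have "(\<lambda>s. complex_of_real (indicator {0..h} s)) = indicator {0..h}"
      by (auto simp: indicator_def)
    ultimately show ?thesis by simp
  qed
  have "L1_norm (\<lambda>x. convolve f (indicator {0..h}) x - (LINT s|lborel. indicator {0..h} s) * f x)
      \<le> (LINT s|lborel. L1_norm (\<lambda>x. f (x - s) - f x) * norm (indicator {0..h} s :: complex))"
    by (rule L1_norm_convolve_minus_le(1)[OF fi integrable_indicator_Icc_complex])
  also have "\<dots> \<le> (LINT s|lborel. w * indicator {0..h} s)"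
  proof (rule integral_mono[OF L1_norm_convolve_minus_le(2)[OF fi integrable_indicator_Icc_complex]])
    show "integrable lborel (\<lambda>s. w * indicator {0..h} s)"
      by (intro integrable_mult_right) (simp add: integrable_indicator_iff emeasure_lborel_Icc_eq)
    show "L1_norm (\<lambda>x. f (x - s) - f x) * norm (indicator {0..h} s :: complex) \<le> w * indicator {0..h} s" for s
      using w[of s] by (auto simp: indicator_def)
  qed
  also have "\<dots> = h * w" using h by simp
  finally have "L1_norm (\<lambda>x. convolve f (indicator {0..h}) x - complex_of_real h * f x) \<le> h * w"
    by (simp add: I)
  then show ?case using cmult_mem[OF f, of "complex_of_real h"] by auto
next
  case (Suc n)
  define m where "m = 2 ^ n * h"
  have m: "m > 0" using h by (simp add: m_def)
  note fi = mem_integrable[OF f]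
  let ?c = "indicator {0..m} :: real \<Rightarrow> complex"
  let ?d = "indicator {0..2 * m} :: real \<Rightarrow> complex"
  obtain i where i: "i \<in> D" "L1_norm (\<lambda>x. convolve f ?c x - i x) \<le> m * w"
    using Suc m_def by auto
  have ci: "integrable lborel (\<lambda>s. ?c (s + (-m)))"
    by (intro integrable_translate integrable_indicator_Icc_complex)
  note sc = integrable_convolve[OF fi integrable_indicator_Icc_complex]
  \<comment> \<open>The two halves overlap in the single point \<open>m\<close>.\<close>
  have "AE s in lborel. ?d s = ?c s + ?c (s + (-m))"
    by (rule AE_mp[OF AE_lborel_singleton[of m] AE_I2]) (use m in \<open>auto simp: indicator_def\<close>)
  then have *: "convolve f ?d x = convolve f (\<lambda>s. ?c s + ?c (s + (-m))) x" for x
    unfolding convolve_def using fi by (intro integral_cong_AE) auto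
  have "AE x in lborel. convolve f ?d x = convolve f ?c x + convolve f ?c (x + (-m))"
    using convolve_add_AE[OF fi integrable_indicator_Icc_complex ci] 
    by eventually_elim (simp only: convolve_translate_right *)
  then have "AE x in lborel. convolve f ?d x - (i x + i (x + (-m)))
      = (convolve f ?c x - i x) + (convolve f ?c (x + (-m)) - i (x + (-m)))"
    by eventually_elim (simp add: algebra_simps)
  then have "L1_norm (\<lambda>x. convolve f ?d x - (i x + i (x + (-m))))
     = L1_norm (\<lambda>x. (convolve f ?c x - i x) + (convolve f ?c (x + (-m)) - i (x + (-m))))"
    by (intro L1_norm_AE_cong borel_measurable_integrable Bochner_Integration.integrable_add
        Bochner_Integration.integrable_diff integrable_translate sc mem_integrable[OF i(1)])
      simp_all
  also have "\<dots> \<le> L1_norm (\<lambda>x. convolve f ?c x - i x) + L1_norm (\<lambda>x. convolve f ?c (x + (-m)) - i (x + (-m)))"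
    by (intro L1_norm_add_le Bochner_Integration.integrable_diff integrable_translate sc mem_integrable[OF i(1)])
  also have "L1_norm (\<lambda>x. convolve f ?c (x + (-m)) - i (x + (-m))) = L1_norm (\<lambda>x. convolve f ?c x - i x)"
    by (rule L1_norm_translate)
  finally have "L1_norm (\<lambda>x. convolve f ?d x - (i x + i (x + (-m)))) \<le> 2 * m * w"
    using i(2) by simp
  moreover have "(\<lambda>x. i x + i (x + (-m))) \<in> D" by (intro add_mem translate_mem i(1))
  ultimately show ?case unfolding m_def by (auto simp: mult.assoc)
qed

text \<open>
  By density it is enough to convolve with indicators of intervals, and these are limits of sums of
  translates of \<open>f\<close>.
\<close>
lemma convolve_mem:
  assumes f: "f \<in> D" and g: "integrable lborel g"
  shows "convolve f g \<in> D"
proof -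
  note fi = mem_integrable[OF f]
  define G where "G = {g. integrable lborel g \<and> convolve f g \<in> D}"
  interpret G: L1_closed_subspace G
  proof
    show "(\<lambda>x. 0) \<in> G" using zero_mem by (simp add: G_def convolve_def[abs_def])
    show "(\<lambda>x. g x + h x) \<in> G" if "g \<in> G" "h \<in> G" for g h
    proof -
      have gh: "integrable lborel g" "integrable lborel h" "convolve f g \<in> D" "convolve f h \<in> D"
        using that by (auto simp: G_def)
      have "convolve f (\<lambda>s. g s + h s) \<in> D"
      proof (rule AE_mem[OF add_mem[OF gh(3,4)]])
        show "convolve f (\<lambda>s. g s + h s) \<in> borel_measurable lborel"
          using gh by (intro borel_measurable_integrable integrable_convolve fi) auto
        show "AE x in lborel. convolve f g x + convolve f h x = convolve f (\<lambda>s. g s + h s) x"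
          using convolve_add_AE[OF fi gh(1,2)] by eventually_elim simp
      qed
      then show ?thesis using gh by (simp add: G_def)
    qed
    show "(\<lambda>x. c * g x) \<in> G" if "g \<in> G" for g c
      using that cmult_mem[of "convolve f g" c] by (auto simp: G_def convolve_cmult[abs_def])
    show "g \<in> G" if g: "integrable lborel g"
      and ex: "\<And>e. e > 0 \<Longrightarrow> \<exists>h\<in>G. L1_norm (\<lambda>x. g x - h x) < e" for g
    proof -
      have "convolve f g \<in> D"
      proof (rule closure_mem[OF integrable_convolve[OF fi g]])
        fix e :: real assume "e > 0"
        then have "e / (L1_norm f + 1) > 0" by (simp add: add_nonneg_pos)
        then obtain h where h: "h \<in> G" "L1_norm (\<lambda>x. g x - h x) < e / (L1_norm f + 1)" using ex by blast
        have "L1_norm (\<lambda>x. convolve f g x - convolve f h x) \<le> L1_norm f * L1_norm (\<lambda>x. g x - h x)"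
          using h by (intro L1_norm_convolve_diff_right fi g) (simp add: G_def)
        also have "\<dots> \<le> (L1_norm f + 1) * L1_norm (\<lambda>x. g x - h x)"
          by (intro mult_right_mono) auto
        also have "\<dots> < e"
          using h(2) by (simp add: pos_less_divide_eq add_nonneg_pos mult.commute)
        finally show "\<exists>i\<in>D. L1_norm (\<lambda>x. convolve f g x - i x) < e"
          using h(1) by (auto simp: G_def)
      qed
      then show ?thesis using g by (simp add: G_def)
    qed
  qed (auto simp: G_def)
  have "g \<in> G"
  proof (rule G.everything_if_interval_indicators[OF _ g])
    fix a b :: real assume ab: "a \<le> b"
    define h where "h = b - a"
    have h: "convolve f (indicator {0..h}) \<in> D" if "h > 0"
    proof (rule closure_mem[OF integrable_convolve[OF fi integrable_indicator_Icc_complex]])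
      fix e :: real assume "e > 0"
      then have "e / (2 * h) > 0" using that by simp
      then have "\<forall>\<^sub>F a in at 0. L1_norm (\<lambda>x. f (x + a) - f x) < e / (2 * h)"
        by (intro order_tendstoD(2)[OF L1_translation_continuous[OF fi]])
      then obtain d where d: "d > 0" "\<And>a. a \<noteq> 0 \<Longrightarrow> \<bar>a\<bar> < d \<Longrightarrow> L1_norm (\<lambda>x. f (x + a) - f x) < e / (2 * h)"
        unfolding eventually_at by (auto simp: dist_real_def)
      \<comment> \<open>Bisect \<open>[0, h]\<close> until the pieces are shorter than \<open>d\<close>.\<close>
      obtain n where n: "h / d < 2 ^ n" using real_arch_pow[of 2 "h / d"] by auto
      define m where "m = h / 2 ^ n"
      have m: "0 < m" "m < d" "2 ^ n * m = h"
        using n d(1) that by (auto simp: m_def field_simps)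
      have "\<exists>i\<in>D. L1_norm (\<lambda>x. convolve f (indicator {0..2 ^ n * m}) x - i x) \<le> 2 ^ n * m * (e / (2 * h))"
      proof (rule convolve_indicator_approx[OF f m(1)])
        fix s assume s: "0 \<le> s" "s \<le> m"
        show "L1_norm (\<lambda>x. f (x - s) - f x) \<le> e / (2 * h)"
        proof (cases "s = 0")
          case True
          then show ?thesis using \<open>e > 0\<close> that by (simp add: L1_norm_def)
        next
          case False
          then show ?thesis using d(2)[of "-s"] s m by simp
        qed
      qed
      moreover have "h * (e / (2 * h)) < e" using that \<open>e > 0\<close> by simp
      ultimately show "\<exists>i\<in>D. L1_norm (\<lambda>x. convolve f (indicator {0..h}) x - i x) < e"
        unfolding m(3) by (meson le_less_trans)
    qed
    have h0: "convolve f (indicator {0..h}) \<in> D"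
    proof (cases "h = 0")
      case True
      have "convolve f (indicator {0..h}) x = 0" for x
      proof -
        have "AE s in lborel. f (x - s) * indicator {0..h} s = 0"
          by (rule AE_mp[OF AE_lborel_singleton[of 0] AE_I2]) (auto simp: True indicator_def)
        then show ?thesis unfolding convolve_def by (rule integral_eq_zero_AE)
      qed
      then have "convolve f (indicator {0..h}) = (\<lambda>x. 0)" by blast
      then show ?thesis using zero_mem by simp
    next
      case False
      then show ?thesis using h ab by (simp add: h_def)
    qed
    have "convolve f (indicator {a..b}) x = convolve f (indicator {0..h}) (x + (- a))" for x
    proof -
      have "indicator {a..b} = (\<lambda>s. indicator {0..h} (s + (-a)) :: complex)"
        by (auto simp: indicator_def h_def)
      then show ?thesis using convolve_translate_right[of f "indicator {0..h}" "-a" x] by simp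
    qed
    then have "convolve f (indicator {a..b}) = (\<lambda>x. convolve f (indicator {0..h}) (x + (- a)))" by blast
    then show "indicator {a..b} \<in> G"
      using translate_mem[OF h0, of "-a"] by (simp add: G_def integrable_indicator_Icc_complex)
  qed
  then show ?thesis by (simp add: G_def)
qed

end

section \<open>Characters and the Fourier transform\<close>

lemma borel_measurable_character [measurable]:
  assumes [measurable]: "f \<in> borel_measurable M"
  shows "(\<lambda>x. character w (f x)) \<in> borel_measurable M"
  unfolding character_def by measurable

lemma borel_measurable_character_frequency [measurable]:
  assumes [measurable]: "f \<in> borel_measurable M"
  shows "(\<lambda>x. character (f x) t) \<in> borel_measurable M"
  unfolding character_def by measurable

lemma norm_character [simp]: "norm (character w t) = 1"
  by (simp add: character_def norm_exp_i_times)

lemma character_eq_cis: "character w t = cis (w * t)"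
  by (simp add: character_def cis_conv_exp)

lemma character_0 [simp]: "character w 0 = 1" "character 0 t = 1"
  by (simp_all add: character_def)

lemma character_add: "character w (s + t) = character w s * character w t"
  by (simp add: character_def distrib_left flip: exp_add)

lemma character_add_freq: "character (v + w) t = character v t * character w t"
  by (simp add: character_def distrib_left distrib_right flip: exp_add)

lemma character_minus_mult [simp]: "character (- w) t * character w t = 1"
  using character_add_freq[of "-w" w t] by simp

lemma character_commute: "character w t = character t w"
  by (simp add: character_def mult.commute)

lemma integrable_character_mult:
  assumes "integrable lborel f"
  shows "integrable lborel (\<lambda>t. character w t * f t)"
proof (rule Bochner_Integration.integrable_bound[OF assms])
  show "(\<lambda>t. character w t * f t) \<in> borel_measurable lborel" using assms by measurable
qed (simp add: norm_mult)

lemma L1_norm_character_mult: "L1_norm (\<lambda>t. character w t * f t) = L1_norm f"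
  by (simp add: L1_norm_def norm_mult)

lemma fourier_lborel:
  assumes "f \<in> borel_measurable lborel"
  shows "fourier f w = (LINT t|lborel. character (- w) t * f t)"
proof -
  have "(\<lambda>t. character (- w) t * f t) \<in> borel_measurable lborel" using assms by measurable
  from integral_completion[OF this] show ?thesis by (simp add: fourier_def character_def)
qed

lemma convolve_character_mult:
  "convolve (\<lambda>t. character w t * f t) (\<lambda>t. character w t * g t) x = character w x * convolve f g x"
proof -
  have "convolve (\<lambda>t. character w t * f t) (\<lambda>t. character w t * g t) x
      = (LINT s|lborel. character w x * (f (x - s) * g s))"
    unfolding convolve_def
  proof (rule Bochner_Integration.integral_cong)
    fix s
    have "character w x = character w (x - s) * character w s" by (simp flip: character_add)
    then show "character w (x - s) * f (x - s) * (character w s * g s) = character w x * (f (x - s) * g s)"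
      by simp
  qed simp
  then show ?thesis by (simp add: convolve_def)
qed

lemma fourier_convolve:
  assumes f: "integrable lborel f" and g: "integrable lborel g"
  shows "fourier (convolve f g) w = fourier f w * fourier g w"
proof -
  have "fourier (convolve f g) w = (LINT t|lborel. character (- w) t * convolve f g t)"
    using integrable_convolve[OF f g] by (intro fourier_lborel) auto
  also have "\<dots> = (LINT t|lborel. convolve (\<lambda>t. character (- w) t * f t) (\<lambda>t. character (- w) t * g t) t)"
    by (simp add: convolve_character_mult)
  also have "\<dots> = fourier f w * fourier g w"
    using f g by (subst integral_convolve) (auto intro: integrable_character_mult simp: fourier_lborel)
  finally show ?thesis .
qed

lemma fourier_diff_cmult:
  assumes f: "integrable lborel f" and g: "integrable lborel g"
  shows "fourier (\<lambda>t. f t - c * g t) w = fourier f w - c * fourier g w"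
proof -
  have "fourier (\<lambda>t. f t - c * g t) w = (LINT t|lborel. character (- w) t * (f t - c * g t))"
    using f g by (intro fourier_lborel) auto
  also have "\<dots> = (LINT t|lborel. character (- w) t * f t - c * (character (- w) t * g t))"
    by (simp add: algebra_simps)
  also have "\<dots> = fourier f w - c * fourier g w"
    using f g by (subst Bochner_Integration.integral_diff)
      (auto simp: fourier_lborel intro!: integrable_character_mult integrable_mult_right)
  finally show ?thesis .
qed

text \<open>
  If \<open>k\<close> is an inverse Fourier integral, convolution with \<open>g\<close> multiplies its density by the Fourier transform of \<open>g\<close>.
  So two functions whose transforms agree on the support of the density have the same convolution with \<open>k\<close>.
\<close>
lemma convolve_inverse_fourier:
  fixes v g :: "real \<Rightarrow> complex"
  assumes v: "integrable lborel v" and g: "integrable lborel g"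
    and k: "\<And>t. k t = (LINT u|lborel. v u * character u t)"
  shows "convolve k g x = (LINT u|lborel. v u * character u x * fourier g u)"
proof -
  let ?F = "\<lambda>s u. v u * character u (x - s) * g s"
  have int: "integrable (lborel \<Otimes>\<^sub>M lborel) (\<lambda>(s, u). ?F s u)"
  proof (rule lborel_pair.Fubini_integrable)
    have [measurable]: "v \<in> borel_measurable borel" "g \<in> borel_measurable borel" using v g by auto
    have [measurable]: "(\<lambda>p. character (snd p) (x - fst p)) \<in> borel_measurable (lborel \<Otimes>\<^sub>M lborel)"
      unfolding character_def by measurable
    show "(\<lambda>(s, u). ?F s u) \<in> borel_measurable (lborel \<Otimes>\<^sub>M lborel)"
      unfolding case_prod_beta' by measurable
    show "integrable lborel (\<lambda>s. LINT u|lborel. norm (case (s, u) of (s, u) \<Rightarrow> ?F s u))"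
      using g v by (simp add: norm_mult)
    show "AE s in lborel. integrable lborel (\<lambda>u. case (s, u) of (s, u) \<Rightarrow> ?F s u)"
    proof (rule AE_I2)
      fix s
      have "integrable lborel (\<lambda>u. character (x - s) u * v u)" by (rule integrable_character_mult[OF v])
      then show "integrable lborel (\<lambda>u. case (s, u) of (s, u) \<Rightarrow> ?F s u)"
        by (simp add: character_commute[of _ "x - s"] mult.commute)
    qed
  qed
  have "convolve k g x = (LINT s|lborel. LINT u|lborel. ?F s u)"
    by (simp add: convolve_def k)
  also have "\<dots> = (LINT u|lborel. LINT s|lborel. ?F s u)"
    by (rule lborel_pair.Fubini_integral[OF int, symmetric])
  also have "\<dots> = (LINT u|lborel. v u * character u x * fourier g u)"
  proof (rule Bochner_Integration.integral_cong)
    fix u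
    have "character u (x - s) = character u x * character (- u) s" for s
      using character_add[of u x "- s"] by (simp add: character_def)
    then have "?F s u = (v u * character u x) * (character (- u) s * g s)" for s
      by (simp only: mult.assoc)
    then have "(LINT s|lborel. ?F s u) = (LINT s|lborel. (v u * character u x) * (character (- u) s * g s))"
      by (simp only:)
    also have "\<dots> = v u * character u x * fourier g u"
      using g by (simp add: fourier_lborel)
    finally show "(LINT s|lborel. ?F s u) = v u * character u x * fourier g u" .
  qed simp
  finally show ?thesis .
qed

section \<open>Fejer kernels\<close>

definition tent :: "real \<Rightarrow> real"
  where "tent u = max 0 (1 - \<bar>u\<bar>)"

text \<open>
  The inverse Fourier integral of the tent without the factor \<open>1 / (2 pi)\<close>; the value at \<open>0\<close> is the
  continuous extension.
\<close>
definition fejer :: "real \<Rightarrow> real"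
  where "fejer t = (if t = 0 then 1 else 2 * (1 - cos t) / t\<^sup>2)"

lemma one_minus_cos_le: "1 - cos t \<le> t\<^sup>2 / 2" for t :: real
proof -
  have "(sin (t/2))\<^sup>2 \<le> (t/2)\<^sup>2"
    using abs_sin_x_le_abs_x[of "t/2"] by (simp only: abs_le_square_iff)
  then show ?thesis using cos_double_sin[of "t/2"] by (simp add: power2_eq_square)
qed

lemma fejer_nonneg: "0 \<le> fejer t"
  by (simp add: fejer_def)

lemma borel_measurable_fejer [measurable]: "fejer \<in> borel_measurable borel"
  unfolding fejer_def[abs_def] by measurable

lemma integrable_cauchy_density: "integrable lborel (\<lambda>x::real. inverse (1 + x\<^sup>2))"
  using integrable_inverse_1_plus_square by (simp add: set_integrable_def)

lemma integrable_fejer: "integrable lborel fejer"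
proof (rule Bochner_Integration.integrable_bound)
  show "integrable lborel (\<lambda>x::real. 5 * inverse (1 + x\<^sup>2))"
    using integrable_cauchy_density by simp
  have "fejer t \<le> 5 * inverse (1 + t\<^sup>2)" for t
  proof (cases "t = 0")
    case False
    have "2 * (1 - cos t) + t\<^sup>2 * (2 * (1 - cos t)) \<le> t\<^sup>2 + t\<^sup>2 * 4"
      using one_minus_cos_le[of t] cos_ge_minus_one[of t] by (intro add_mono mult_left_mono) (auto simp del: cos_ge_minus_one)
    then have "(2 * (1 - cos t)) * (1 + t\<^sup>2) \<le> 5 * t\<^sup>2" by (simp add: algebra_simps)
    then show ?thesis using False
      by (simp add: fejer_def field_simps add_pos_nonneg)
  qed (simp add: fejer_def)
  then show "AE x in lborel. norm (fejer x) \<le> norm (5 * inverse (1 + x\<^sup>2))"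
    by (intro AE_I2) (simp add: fejer_nonneg)
qed measurable

text \<open>
  The fundamental theorem of calculus on each of the two sides of the tent.
\<close>
lemma fejer_inverse_fourier: "complex_of_real (fejer t) = (LINT u|lborel. of_real (tent u) * character u t)"
proof -
  let ?e = "\<lambda>u. character u t"
  have ae: "AE u in lborel. of_real (tent u) * ?e u
      = indicator {-1..0} u *\<^sub>R (of_real (1 + u) * ?e u) + indicator {0..1} u *\<^sub>R (of_real (1 - u) * ?e u)"
    by (rule AE_mp[OF AE_lborel_singleton[of 0] AE_I2]) (auto simp: tent_def indicator_def)
  have de: "(?e has_vector_derivative \<i> * of_real t * ?e u) (at u within S)" for u S
    unfolding character_def
    by (auto intro!: derivative_eq_intros has_vector_derivative_real_field simp: mult_ac)
  have cont: "continuous_on S (\<lambda>u. of_real (1 + u) * ?e u)" "continuous_on S (\<lambda>u. of_real (1 - u) * ?e u)" for S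
    unfolding character_def by (intro continuous_intros)+
  obtain F G :: "real \<Rightarrow> complex" where
    F: "\<And>u S. (F has_vector_derivative of_real (1 + u) * ?e u) (at u within S)" and
    G: "\<And>u S. (G has_vector_derivative of_real (1 - u) * ?e u) (at u within S)" and
    FG: "F 0 - F (-1) + (G 1 - G 0) = of_real (fejer t)"
  proof (cases "t = 0")
    case True
    show thesis
    proof (rule that)
      show "((\<lambda>u. complex_of_real (u + u\<^sup>2 / 2)) has_vector_derivative of_real (1 + u) * ?e u) (at u within S)" for u S
      proof -
        have "((\<lambda>u. u + u\<^sup>2 / 2) has_real_derivative 1 + u) (at u within S)"
          by (auto intro!: derivative_eq_intros)
        from has_vector_derivative_of_real[OF this]
        have "((\<lambda>u. complex_of_real (u + u\<^sup>2 / 2)) has_vector_derivative of_real (1 + u)) (at u within S)" .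
        then show ?thesis using True by (simp only: character_0 mult_1_right)
      qed
      show "((\<lambda>u. complex_of_real (u - u\<^sup>2 / 2)) has_vector_derivative of_real (1 - u) * ?e u) (at u within S)" for u S
      proof -
        have "((\<lambda>u. u - u\<^sup>2 / 2) has_real_derivative 1 - u) (at u within S)"
          by (auto intro!: derivative_eq_intros)
        from has_vector_derivative_of_real[OF this]
        have "((\<lambda>u. complex_of_real (u - u\<^sup>2 / 2)) has_vector_derivative of_real (1 - u)) (at u within S)" .
        then show ?thesis using True by (simp only: character_0 mult_1_right)
      qed
    qed (simp add: True fejer_def)
  next
    case False
    show thesis
    proof (rule that)
      show "((\<lambda>u. of_real (1 + u) * ?e u / (\<i> * of_real t) + ?e u / (of_real t)\<^sup>2)
          has_vector_derivative of_real (1 + u) * ?e u) (at u within S)" for u S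
        by (rule has_vector_derivative_eq_rhs, (rule derivative_intros de)+)
           (use False in \<open>simp add: field_simps power2_eq_square\<close>)
      show "((\<lambda>u. of_real (1 - u) * ?e u / (\<i> * of_real t) - ?e u / (of_real t)\<^sup>2)
          has_vector_derivative of_real (1 - u) * ?e u) (at u within S)" for u S
        by (rule has_vector_derivative_eq_rhs, (rule derivative_intros de)+)
           (use False in \<open>simp add: field_simps power2_eq_square\<close>)
      have "character 1 t + character (-1) t = 2 * of_real (cos t)"
        by (simp add: character_eq_cis complex_eq_iff)
      then have *: "character (-1) t = 2 * of_real (cos t) - character 1 t" by (simp add: algebra_simps)
      show "of_real (1 + 0) * ?e 0 / (\<i> * of_real t) + ?e 0 / (of_real t)\<^sup>2
        - (of_real (1 + -1) * ?e (-1) / (\<i> * of_real t) + ?e (-1) / (of_real t)\<^sup>2)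
        + (of_real (1 - 1) * ?e 1 / (\<i> * of_real t) - ?e 1 / (of_real t)\<^sup>2
           - (of_real (1 - 0) * ?e 0 / (\<i> * of_real t) - ?e 0 / (of_real t)\<^sup>2)) = of_real (fejer t)"
        using False by (simp add: * fejer_def diff_divide_distrib)
    qed
  qed
  have 1: "has_bochner_integral lborel (\<lambda>u. indicator {-1..0} u *\<^sub>R (of_real (1 + u) * ?e u)) (F 0 - F (-1))"
    by (rule has_bochner_integral_FTC_Icc[OF _ F cont(1)]) simp
  have 2: "has_bochner_integral lborel (\<lambda>u. indicator {0..1} u *\<^sub>R (of_real (1 - u) * ?e u)) (G 1 - G 0)"
    by (rule has_bochner_integral_FTC_Icc[OF _ G cont(2)]) simp
  have "(LINT u|lborel. of_real (tent u) * ?e u) = (LINT u|lborel. indicator {-1..0} u *\<^sub>R (of_real (1 + u) * ?e u)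
      + indicator {0..1} u *\<^sub>R (of_real (1 - u) * ?e u))"
    by (rule integral_cong_AE[OF _ _ ae]) (simp_all add: tent_def)
  also have "\<dots> = F 0 - F (-1) + (G 1 - G 0)"
    by (rule has_bochner_integral_integral_eq[OF has_bochner_integral_add[OF 1 2]])
  finally show ?thesis using FG by simp
qed

text \<open>
  The kernel whose density is the tent of height \<open>1\<close> with centre \<open>b\<close> and half-width \<open>d\<close>.
\<close>
definition tent_kernel :: "real \<Rightarrow> real \<Rightarrow> real \<Rightarrow> complex"
  where "tent_kernel b d t = character b t * of_real (d * fejer (d * t))"

lemma integrable_tent: "integrable lborel tent"
proof (rule Bochner_Integration.integrable_bound)
  show "integrable lborel (indicator {-1..1} :: real \<Rightarrow> real)"
    by (simp add: integrable_indicator_iff emeasure_lborel_Icc_eq)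
  show "tent \<in> borel_measurable lborel" unfolding tent_def[abs_def] by measurable
qed (auto simp: tent_def indicator_def)

lemma tent_kernel_inverse_fourier:
  assumes d: "d > 0"
  shows "tent_kernel b d t = (LINT u|lborel. of_real (tent ((u - b) / d)) * character u t)"
proof -
  have "(LINT u|lborel. of_real (tent ((u - b) / d)) * character u t)
     = d *\<^sub>R (LINT u|lborel. of_real (tent u) * character (b + d * u) t)"
    using d lborel_integral_real_affine[of d "\<lambda>u. of_real (tent ((u - b) / d)) * character u t" b] by simp
  also have "(LINT u|lborel. of_real (tent u) * character (b + d * u) t)
     = (LINT u|lborel. character b t * (of_real (tent u) * character u (d * t)))"
    by (rule Bochner_Integration.integral_cong) (auto simp: character_add_freq, simp add: character_def mult_ac)
  also have "\<dots> = character b t * of_real (fejer (d * t))"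
    by (simp add: fejer_inverse_fourier)
  finally show ?thesis by (simp add: tent_kernel_def scaleR_conv_of_real mult_ac)
qed

lemma integrable_tent_scaled:
  assumes "d > 0"
  shows "integrable lborel (\<lambda>u. complex_of_real (tent ((u - b) / d)))"
proof (rule integrable_of_real)
  have "integrable lborel (\<lambda>u. tent (- b / d + (1 / d) * u))"
    using assms by (intro lborel_integrable_real_affine integrable_tent) simp
  then show "integrable lborel (\<lambda>u. tent ((u - b) / d))"
    by (simp add: diff_divide_distrib)
qed

lemma convolve_tent_kernel:
  assumes "d > 0" "integrable lborel g"
  shows "convolve (tent_kernel b d) g x
    = (LINT u|lborel. of_real (tent ((u - b) / d)) * character u x * fourier g u)"
  by (rule convolve_inverse_fourier[OF integrable_tent_scaled[OF assms(1)] assms(2)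
      tent_kernel_inverse_fourier[OF assms(1)]])

lemma L1_norm_dilate:
  assumes "d > 0"
  shows "L1_norm (\<lambda>x. of_real d * f (d * x)) = L1_norm f"
  using assms lborel_integral_real_affine[of d "\<lambda>x. norm (f x)" 0]
  by (simp add: L1_norm_def norm_mult)

lemma integrable_dilate:
  fixes f :: "real \<Rightarrow> complex"
  assumes "d > 0" "integrable lborel f"
  shows "integrable lborel (\<lambda>x. of_real d * f (d * x))"
  using lborel_integrable_real_affine[OF assms(2), of d 0] assms(1) by simp

lemma integrable_tent_kernel:
  assumes "d > 0"
  shows "integrable lborel (tent_kernel b d)"
proof -
  have "integrable lborel (\<lambda>x. complex_of_real d * of_real (fejer (d * x)))"
    by (rule integrable_dilate[OF assms]) (intro integrable_of_real integrable_fejer)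
  from integrable_character_mult[OF this] show ?thesis by (simp add: tent_kernel_def[abs_def])
qed

lemma L1_norm_tent_kernel:
  assumes "d > 0"
  shows "L1_norm (tent_kernel b d) = L1_norm (\<lambda>x. of_real (fejer x))"
  using L1_norm_dilate[OF assms, of "\<lambda>x. of_real (fejer x)"]
    L1_norm_character_mult[of b "\<lambda>x. of_real d * of_real (fejer (d * x))"]
  by (simp add: tent_kernel_def[abs_def])

text \<open>
  A piecewise linear function is the interpolation of its values on any finer grid; on the kernel
  side this is the double angle formula.
\<close>
lemma tent_kernel_refine:
  "tent_kernel b d t = 1/2 * tent_kernel (b - d/2) (d/2) t + tent_kernel b (d/2) t
     + 1/2 * tent_kernel (b + d/2) (d/2) t"
proof -
  have 1: "character (b - d/2) t = character b t * character (-d/2) t"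
    "character (b + d/2) t = character b t * character (d/2) t"
    by (simp_all flip: character_add_freq)
  have c: "character (-d/2) t + character (d/2) t = 2 * of_real (cos (d/2 * t))"
    by (simp add: character_eq_cis complex_eq_iff)
  have f: "d * fejer (d * t) = (cos (d/2 * t) + 1) * (d/2 * fejer (d/2 * t))"
  proof (cases "d * t = 0")
    case True then show ?thesis by (auto simp: fejer_def)
  next
    case False
    have "cos (d * t) = 2 * (cos (d/2 * t))\<^sup>2 - 1"
      using cos_double_cos[of "d/2 * t"] by (simp add: field_simps)
    then show ?thesis using False
      by (simp add: fejer_def divide_simps power2_eq_square) (simp add: algebra_simps)
  qed
  have "1/2 * tent_kernel (b - d/2) (d/2) t + tent_kernel b (d/2) t + 1/2 * tent_kernel (b + d/2) (d/2) t
     = character b t * of_real (d/2 * fejer (d/2 * t)) * ((character (-d/2) t + character (d/2) t) / 2 + 1)"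
    unfolding tent_kernel_def 1 by (simp add: algebra_simps)
  also have "\<dots> = character b t * of_real ((cos (d/2 * t) + 1) * (d/2 * fejer (d/2 * t)))"
    unfolding c by (simp add: algebra_simps)
  finally show ?thesis unfolding tent_kernel_def f by simp
qed

section \<open>A kernel whose Fourier transform is constant near the origin\<close>

text \<open>
  The value is \<open>pi\<close>; it normalises the kernel below.
\<close>
definition versine_mass :: real
  where "versine_mass = (LINT t|lborel. (1 - cos t) / t\<^sup>2)"

lemma versine_quotient_eq_fejer: "t \<noteq> 0 \<Longrightarrow> (1 - cos t) / t\<^sup>2 = fejer t / 2"
  by (simp add: fejer_def field_simps)

lemma integrable_versine_quotient: "integrable lborel (\<lambda>t. (1 - cos (a * t)) / t\<^sup>2)" for a :: real
proof (cases "a = 0")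
  case False
  have "integrable lborel (\<lambda>t::real. (1 - cos t) / t\<^sup>2)"
  proof (rule Bochner_Integration.integrable_bound[OF integrable_fejer])
    show "AE x in lborel. norm ((1 - cos x) / x\<^sup>2) \<le> norm (fejer x)"
      by (intro AE_I2) (auto simp: fejer_def intro!: divide_right_mono)
  qed measurable
  from integrable_mult_right[OF lborel_integrable_real_affine[OF this False, of 0], of "a\<^sup>2"]
  show ?thesis using False by (simp add: power_mult_distrib)
qed simp

text \<open>
  A dilation of the variable. The absolute value makes combinations over several frequencies piecewise linear
  in the frequency.
\<close>
lemma integral_versine_quotient: "(LINT t|lborel. (1 - cos (a * t)) / t\<^sup>2) = \<bar>a\<bar> * versine_mass"
proof (cases "a = 0")
  case False
  have "versine_mass = \<bar>a\<bar> * (LINT t|lborel. (1 - cos (a * t)) / (a * t)\<^sup>2)"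
    unfolding versine_mass_def using lborel_integral_real_affine[OF False, of "\<lambda>t. (1 - cos t) / t\<^sup>2" 0] by simp
  also have "(LINT t|lborel. (1 - cos (a * t)) / (a * t)\<^sup>2) = (LINT t|lborel. (1 - cos (a * t)) / t\<^sup>2) / a\<^sup>2"
    by (simp add: power_mult_distrib mult.commute flip: integral_divide_zero)
  finally have "\<bar>a\<bar> * (\<bar>a\<bar> * versine_mass) = \<bar>a\<bar> * (LINT t|lborel. (1 - cos (a * t)) / t\<^sup>2)"
    using False by (simp add: field_simps power2_eq_square)
  then show ?thesis using False by simp
qed simp

lemma versine_mass_pos: "versine_mass > 0"
proof -
  have "(LINT t|lborel. ((1 - cos 1) / 4) * indicator {1..2::real} t) \<le> versine_mass"
    unfolding versine_mass_def
  proof (rule integral_mono)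
    show "integrable lborel (\<lambda>t. ((1 - cos 1) / 4) * indicator {1..2::real} t :: real)"
      by (intro integrable_mult_right) (simp add: integrable_indicator_iff emeasure_lborel_Icc_eq)
    show "integrable lborel (\<lambda>t::real. (1 - cos t) / t\<^sup>2)"
      using integrable_versine_quotient[of 1] by simp
    show "(1 - cos 1) / 4 * indicator {1..2} t \<le> (1 - cos t) / t\<^sup>2" for t :: real
    proof (cases "t \<in> {1..2}")
      case True
      have "cos t \<le> cos 1" using True pi_gt3 by (intro cos_monotone_0_pi_le) auto
      moreover have "t\<^sup>2 \<le> 4" using True power_mono[of t 2 2] by simp
      ultimately have "(1 - cos 1) / 4 \<le> (1 - cos t) / t\<^sup>2"
        using True by (intro frac_le) auto
      then show ?thesis using True by simp
    qed simp
  qed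
  moreover have "cos (1::real) < 1" using cos_monotone_0_pi[of 0 1] pi_gt3 by simp
  ultimately show ?thesis by simp
qed

lemma fejer_integral_pos: "0 < (LINT t|lborel. fejer t)"
proof -
  have "versine_mass = (LINT t|lborel. fejer t / 2)"
    unfolding versine_mass_def
    by (rule integral_cong_AE)
       (use versine_quotient_eq_fejer in \<open>auto intro: AE_mp[OF AE_lborel_singleton[of 0] AE_I2]\<close>)
  then show ?thesis using versine_mass_pos by simp
qed

text \<open>
  A difference of two Fejer kernels, with transforms of half-width \<open>2\<close> and \<open>1\<close> (a de la Vallee-Poussin kernel). Its Fourier transform is a
  trapezium with plateau \<open>[-1, 1]\<close>.
\<close>
definition plateau_kernel :: "real \<Rightarrow> complex"
  where "plateau_kernel t = of_real ((cos t - cos (2 * t)) / t\<^sup>2 / versine_mass)"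

lemma plateau_kernel_eq:
  "plateau_kernel t = of_real (((1 - cos (2 * t)) / t\<^sup>2 - (1 - cos (1 * t)) / t\<^sup>2) / versine_mass)"
  by (simp add: plateau_kernel_def diff_divide_distrib)

lemma integrable_plateau_kernel: "integrable lborel plateau_kernel"
  unfolding plateau_kernel_eq[abs_def]
  by (intro integrable_of_real integrable_divide Bochner_Integration.integrable_diff integrable_versine_quotient)

text \<open>
  The transform is even, so the exponential may be replaced by a cosine. Product formulas turn the
  integrand into four versine quotients with frequencies \<open>2 \<plusminus> w\<close> and \<open>1 \<plusminus> w\<close>.
\<close>
lemma fourier_plateau_kernel:
  assumes "\<bar>w\<bar> \<le> 1"
  shows "fourier plateau_kernel w = 1"
proof -
  have int: "integrable lborel (\<lambda>t. character w t * plateau_kernel t)" for w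
    by (rule integrable_character_mult[OF integrable_plateau_kernel])
  have F: "fourier plateau_kernel w = (LINT t|lborel. character (- w) t * plateau_kernel t)" for w
    using integrable_plateau_kernel by (intro fourier_lborel) auto
  have even: "fourier plateau_kernel (- w) = fourier plateau_kernel w"
    using lborel_integral_real_affine[of "-1" "\<lambda>t. character w t * plateau_kernel t" 0]
    by (simp add: F character_def plateau_kernel_def)
  let ?q = "\<lambda>a t. (1 - cos (a * t)) / t\<^sup>2"
  have "2 * fourier plateau_kernel w = (LINT t|lborel. character (- w) t * plateau_kernel t + character w t * plateau_kernel t)"
    using F[of w] F[of "-w"] even int by (subst Bochner_Integration.integral_add) simp_all
  also have "\<dots> = (LINT t|lborel. complex_of_real ((?q (2 + w) t + ?q (2 - w) t - ?q (1 + w) t - ?q (1 - w) t) / versine_mass))"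
  proof (rule Bochner_Integration.integral_cong)
    fix t :: real
    have "character (- w) t * plateau_kernel t + character w t * plateau_kernel t
       = (character (- w) t + character w t) * plateau_kernel t" by (simp add: distrib_right)
    also have "character (- w) t + character w t = of_real (2 * cos (w * t))"
      by (simp add: character_eq_cis complex_eq_iff)
    also have "of_real (2 * cos (w * t)) * plateau_kernel t
      = of_real ((2 * cos (w * t) * cos t - 2 * cos (w * t) * cos (2 * t)) / t\<^sup>2 / versine_mass)"
      by (simp add: plateau_kernel_def algebra_simps)
    also have "2 * cos (w * t) * cos t - 2 * cos (w * t) * cos (2 * t)
       = (1 - cos ((2 + w) * t)) + (1 - cos ((2 - w) * t)) - (1 - cos ((1 + w) * t)) - (1 - cos ((1 - w) * t))"
      by (simp add: distrib_right left_diff_distrib cos_add cos_diff)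
    finally show "character (- w) t * plateau_kernel t + character w t * plateau_kernel t
       = complex_of_real ((?q (2 + w) t + ?q (2 - w) t - ?q (1 + w) t - ?q (1 - w) t) / versine_mass)"
      by (simp add: diff_divide_distrib add_divide_distrib)
  qed simp
  also have "\<dots> = complex_of_real ((LINT t|lborel. ?q (2 + w) t + ?q (2 - w) t - ?q (1 + w) t - ?q (1 - w) t) / versine_mass)"
    by (simp only: integral_complex_of_real integral_divide_zero)
  also have "(LINT t|lborel. ?q (2 + w) t + ?q (2 - w) t - ?q (1 + w) t - ?q (1 - w) t)
     = (\<bar>2 + w\<bar> + \<bar>2 - w\<bar> - \<bar>1 + w\<bar> - \<bar>1 - w\<bar>) * versine_mass"
    by (simp only: Bochner_Integration.integral_diff Bochner_Integration.integral_add
        Bochner_Integration.integrable_diff Bochner_Integration.integrable_add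
        integrable_versine_quotient integral_versine_quotient) (simp add: algebra_simps)
  also have "\<bar>2 + w\<bar> + \<bar>2 - w\<bar> - \<bar>1 + w\<bar> - \<bar>1 - w\<bar> = 2" using assms by auto
  finally show ?thesis using versine_mass_pos by simp
qed

lemma fourier_dilate:
  assumes d: "d > 0" and f: "integrable lborel f"
  shows "fourier (\<lambda>x. of_real d * f (d * x)) w = fourier f (w / d)"
proof -
  have "fourier (\<lambda>x. of_real d * f (d * x)) w = (LINT t|lborel. character (- w) t * (of_real d * f (d * t)))"
    using integrable_dilate[OF d f] by (intro fourier_lborel) simp
  also have "\<dots> = (LINT t|lborel. of_real d * (character (- (w / d)) (d * t) * f (d * t)))"
    by (rule Bochner_Integration.integral_cong) (use d in \<open>auto simp: character_def\<close>)
  also have "\<dots> = (LINT t|lborel. character (- (w / d)) t * f t)"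
    using d lborel_integral_real_affine[of d "\<lambda>t. character (- (w / d)) t * f t" 0]
    by (simp add: scaleR_conv_of_real)
  also have "\<dots> = fourier f (w / d)" using f by (subst fourier_lborel) auto
  finally show ?thesis .
qed

lemma L1_translation_isCont:
  assumes "integrable lborel f"
  shows "isCont (\<lambda>a. L1_norm (\<lambda>x. f (x + a) - f x)) 0"
  using L1_translation_continuous[OF assms] by (simp add: isCont_def L1_norm_def)

text \<open>
  A widely dilated kernel hardly changes under the translations that matter for \<open>f\<close>, so convolving it with \<open>f\<close>
  nearly multiplies it by the number \<open>\<integral> f\<close>. On the Fourier side: the transform of \<open>f\<close> is almost constant near
  \<open>0\<close>, in the norm of transforms of integrable functions.
\<close>
lemma approximate_identity_eigen:
  assumes f: "integrable lborel f" and v: "integrable lborel v" and e: "e > 0"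
  shows "\<exists>d>0. L1_norm (\<lambda>x. convolve (\<lambda>x. of_real d * v (d * x)) f x
      - (LINT s|lborel. f s) * (of_real d * v (d * x))) < e"
proof -
  define d where "d n = 1 / real (Suc n)" for n
  have d: "d n > 0" for n by (simp add: d_def)
  define V where "V n x = of_real (d n) * v (d n * x)" for n x
  have V: "integrable lborel (V n)" for n
    unfolding V_def[abs_def] by (rule integrable_dilate[OF d v])
  have N: "L1_norm (\<lambda>x. V n (x - s) - V n x) = L1_norm (\<lambda>x. v (x + - (d n * s)) - v x)" for n s
    using L1_norm_dilate[OF d, of n "\<lambda>x. v (x + - (d n * s)) - v x"]
    by (simp add: V_def right_diff_distrib)
  have "(\<lambda>n. LINT s|lborel. L1_norm (\<lambda>x. V n (x - s) - V n x) * norm (f s)) \<longlonglongrightarrow> (LINT s|(lborel::real measure). (0::real))"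
  proof (rule integral_dominated_convergence[where w="\<lambda>s. 2 * L1_norm v * norm (f s)"])
    show "integrable lborel (\<lambda>s. 2 * L1_norm v * norm (f s))" using f by simp
    show "(\<lambda>s. L1_norm (\<lambda>x. V n (x - s) - V n x) * norm (f s)) \<in> borel_measurable lborel" for n
      by (rule borel_measurable_integrable[OF L1_norm_convolve_minus_le(2)[OF V f]])
    show "AE s in lborel. (\<lambda>n. L1_norm (\<lambda>x. V n (x - s) - V n x) * norm (f s)) \<longlonglongrightarrow> 0"
    proof (rule AE_I2)
      fix s
      have "(\<lambda>n. - (d n * s)) \<longlonglongrightarrow> - (0 * s)"
        unfolding d_def by (intro tendsto_intros LIMSEQ_Suc lim_1_over_n)
      then have "(\<lambda>n. L1_norm (\<lambda>x. v (x + - (d n * s)) - v x)) \<longlonglongrightarrow> 0"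
        using isCont_tendsto_compose[OF L1_translation_isCont[OF v], of "\<lambda>n. - (d n * s)" sequentially]
        by (simp add: L1_norm_def)
      then show "(\<lambda>n. L1_norm (\<lambda>x. V n (x - s) - V n x) * norm (f s)) \<longlonglongrightarrow> 0"
        unfolding N by (rule tendsto_mult_left_zero)
    qed
    show "AE s in lborel. norm (L1_norm (\<lambda>x. V n (x - s) - V n x) * norm (f s)) \<le> 2 * L1_norm v * norm (f s)" for n
    proof (rule AE_I2)
      fix s
      have "L1_norm (\<lambda>x. v (x + - (d n * s)) + - 1 * v x) \<le> L1_norm v + L1_norm v"
        using L1_norm_add_le[OF integrable_translate[OF v, of "- (d n * s)"] integrable_mult_right[OF v, of "-1"]]
          L1_norm_translate[of v "- (d n * s)"] L1_norm_cmult[of "-1" v] by simp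
      then show "norm (L1_norm (\<lambda>x. V n (x - s) - V n x) * norm (f s)) \<le> 2 * L1_norm v * norm (f s)"
        unfolding N by (simp add: abs_mult mult_right_mono)
    qed
  qed simp
  then have "\<forall>\<^sub>F n in sequentially. (LINT s|lborel. L1_norm (\<lambda>x. V n (x - s) - V n x) * norm (f s)) < e"
    using e by (intro order_tendstoD(2)[where y=0]) simp_all
  then obtain n where "(LINT s|lborel. L1_norm (\<lambda>x. V n (x - s) - V n x) * norm (f s)) < e"
    using eventually_happens'[OF sequentially_bot] by blast
  then have "L1_norm (\<lambda>x. convolve (V n) f x - (LINT s|lborel. f s) * V n x) < e"
    using L1_norm_convolve_minus_le(1)[OF V f, of n] by simp
  then show ?thesis using d[of n] unfolding V_def[abs_def] by blast
qed

section \<open>Local inversion and synthesis with tents\<close>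

context L1_closed_ideal
begin

text \<open>
  A Neumann series modulo the ideal. Up to the element \<open>j\<close>, multiplication by \<open>c\<close> acts on \<open>k\<close> as convolution with
  \<open>- R\<close>, which preserves the ideal and halves norms relative to \<open>c\<close>; so each step halves the distance from \<open>k\<close>.
\<close>
lemma mem_if_multiplier_small:
  assumes k: "integrable lborel k" and R: "integrable lborel R" and c: "c \<noteq> 0"
    and j: "j \<in> D" and eq: "\<And>x. convolve k R x = j x - c * k x"
    and small: "2 * L1_norm R \<le> norm c"
  shows "k \<in> D"
proof -
  have approx: "\<exists>i\<in>D. L1_norm (\<lambda>x. k x - i x) \<le> L1_norm k / 2 ^ n" for n
  proof (induction n)
    case 0 then show ?case using zero_mem by (intro bexI[of _ "\<lambda>x. 0"]) auto
  next
    case (Suc n)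
    then obtain i where i: "i \<in> D" "L1_norm (\<lambda>x. k x - i x) \<le> L1_norm k / 2 ^ n" by auto
    define i' where "i' x = 1 / c * (j x - convolve i R x)" for x
    have "i' \<in> D" unfolding i'_def[abs_def]
      by (intro cmult_mem diff_mem j convolve_mem i R)
    moreover have "L1_norm (\<lambda>x. k x - i' x) \<le> L1_norm k / 2 ^ Suc n"
    proof -
      have "k x - i' x = (- 1 / c) * (convolve k R x - convolve i R x)" for x
        using c by (simp add: i'_def eq field_simps)
      then have "L1_norm (\<lambda>x. k x - i' x) = 1 / norm c * L1_norm (\<lambda>x. convolve k R x - convolve i R x)"
        by (simp only: L1_norm_cmult) (simp add: norm_divide)
      also have "\<dots> \<le> 1 / norm c * (L1_norm (\<lambda>x. k x - i x) * L1_norm R)"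
        by (intro mult_left_mono L1_norm_convolve_diff_left k R mem_integrable[OF i(1)]) simp
      also have "\<dots> \<le> 1 / norm c * (L1_norm k / 2 ^ n * (norm c / 2))"
        using small i(2) by (intro mult_left_mono mult_mono) auto
      also have "\<dots> = L1_norm k / 2 ^ Suc n" using c by simp
      finally show ?thesis .
    qed
    ultimately show ?case by blast
  qed
  show ?thesis
  proof (rule closure_mem[OF k])
    fix e :: real assume "e > 0"
    obtain n where "L1_norm k / e < 2 ^ n" using real_arch_pow[of 2 "L1_norm k / e"] by auto
    then have "L1_norm k / 2 ^ n < e" using \<open>e > 0\<close> by (simp add: field_simps)
    then show "\<exists>i\<in>D. L1_norm (\<lambda>x. k x - i x) < e" using approx[of n] by force
  qed
qed

text \<open>
  Wiener's local inversion at \<open>0\<close>. With \<open>V\<close> the dilated plateau kernel and \<open>c = \<integral> f\<close>, the function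
  \<open>R = V * f - c V\<close> has small norm, and where the plateau is \<open>1\<close> its transform is that of \<open>f\<close> minus \<open>c\<close>. A tent
  supported there convolved with \<open>R\<close> gives the same as with \<open>f - c \<delta>\<close>.
\<close>
lemma tent_kernel_mem_near_0:
  assumes f: "f \<in> D" and c: "(LINT x|lborel. f x) \<noteq> 0"
  shows "\<exists>r>0. \<forall>b d. 0 < d \<and> \<bar>b\<bar> + d \<le> r \<longrightarrow> tent_kernel b d \<in> D"
proof -
  note fi = mem_integrable[OF f]
  define c where "c = (LINT x|lborel. f x)"
  obtain r where r: "r > 0" "L1_norm (\<lambda>x. convolve (\<lambda>x. of_real r * plateau_kernel (r * x)) f x
      - c * (of_real r * plateau_kernel (r * x))) < norm c / 2"
    using approximate_identity_eigen[OF fi integrable_plateau_kernel, of "norm c / 2"] c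
    unfolding c_def by auto
  define V where "V x = of_real r * plateau_kernel (r * x)" for x
  have V: "integrable lborel V"
    unfolding V_def[abs_def] by (rule integrable_dilate[OF r(1) integrable_plateau_kernel])
  define R where "R x = convolve V f x - c * V x" for x
  have R: "integrable lborel R"
    unfolding R_def[abs_def] by (intro Bochner_Integration.integrable_diff integrable_convolve integrable_mult_right V fi)
  have fR: "fourier R u = fourier f u - c" if "\<bar>u\<bar> \<le> r" for u
  proof -
    have "fourier V u = 1"
      unfolding V_def[abs_def] fourier_dilate[OF r(1) integrable_plateau_kernel]
      using that r(1) by (intro fourier_plateau_kernel) (simp add: abs_div)
    then show ?thesis unfolding R_def[abs_def]
      by (simp add: fourier_diff_cmult[OF integrable_convolve[OF V fi] V] fourier_convolve[OF V fi])
  qed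
  have "tent_kernel b d \<in> D" if bd: "0 < d" "\<bar>b\<bar> + d \<le> r" for b d
  proof (rule mem_if_multiplier_small)
    show k: "integrable lborel (tent_kernel b d)" by (rule integrable_tent_kernel[OF bd(1)])
    show "integrable lborel R" by (rule R)
    show "convolve f (tent_kernel b d) \<in> D" by (rule convolve_mem[OF f k])
    show "c \<noteq> 0" using c by (simp add: c_def)
    show "2 * L1_norm R \<le> norm c" using r(2) by (simp add: R_def[abs_def] V_def[abs_def])
    show "convolve (tent_kernel b d) R x = convolve f (tent_kernel b d) x - c * tent_kernel b d x" for x
    proof -
      let ?w = "\<lambda>u. of_real (tent ((u - b) / d)) * character u x"
      have w: "?w u * fourier R u = ?w u * fourier f u - c * ?w u" for u
      proof (cases "\<bar>u\<bar> \<le> r")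
        case False
        then have "d \<le> \<bar>u - b\<bar>" using bd by linarith
        then have "1 \<le> \<bar>(u - b) / d\<bar>" using bd(1) by (simp add: abs_div)
        then show ?thesis by (simp add: tent_def)
      qed (simp add: fR algebra_simps)
      have wi: "integrable lborel ?w"
        using integrable_character_mult[OF integrable_tent_scaled[OF bd(1)], of x b]
        by (simp add: character_commute[of x] mult.commute)
      have wf: "integrable lborel (\<lambda>u. ?w u * fourier f u)"
      proof (rule Bochner_Integration.integrable_bound[OF integrable_mult_left[OF wi, of "of_real (L1_norm f)"]])
        have [measurable]: "f \<in> borel_measurable borel" using fi by simp
        have [measurable]: "(\<lambda>p. character (- fst p) (snd p)) \<in> borel_measurable (borel \<Otimes>\<^sub>M lborel)"
          unfolding character_def by measurable
        have "(\<lambda>u. LINT t|lborel. character (- u) t * f t) \<in> borel_measurable borel"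
          by measurable
        then show "(\<lambda>u. ?w u * fourier f u) \<in> borel_measurable lborel"
          using wi fi by (simp add: fourier_lborel)
        have "norm (fourier f u) \<le> L1_norm f" for u
          using fi integral_norm_bound[of lborel "\<lambda>t. character (- u) t * f t"]
          by (simp add: fourier_lborel norm_mult L1_norm_def)
        then show "AE u in lborel. norm (?w u * fourier f u) \<le> norm (?w u * of_real (L1_norm f))"
          by (intro AE_I2) (auto simp: norm_mult intro!: mult_left_mono)
      qed
      have "convolve (tent_kernel b d) R x = (LINT u|lborel. ?w u * fourier f u - c * ?w u)"
        unfolding convolve_tent_kernel[OF bd(1) R] w ..
      also have "\<dots> = (LINT u|lborel. ?w u * fourier f u) - (LINT u|lborel. c * ?w u)"
        by (rule Bochner_Integration.integral_diff[OF wf integrable_mult_right[OF wi]])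
      also have "(LINT u|lborel. ?w u * fourier f u) = convolve (tent_kernel b d) f x"
        by (rule convolve_tent_kernel[OF bd(1) fi, symmetric])
      also have "(LINT u|lborel. c * ?w u) = c * tent_kernel b d x"
        by (simp add: tent_kernel_inverse_fourier[OF bd(1)])
      finally show ?thesis by (simp add: convolve_commute[of f])
    qed
  qed
  then show ?thesis using r(1) by blast
qed

end

context L1_closed_ideal
begin

text \<open>
  Multiplying by a character translates the Fourier transforms, so local statements need a proof only
  at the origin.
\<close>
lemma modulated: "L1_closed_ideal {f. (\<lambda>t. character w t * f t) \<in> D}"
proof (unfold_locales, goal_cases)
  \<comment> \<open>The cases are integrability, the zero function, sums, multiples, limits and translates.\<close>
  case (1 f)
  then have "integrable lborel (\<lambda>t. character (- w) t * (character w t * f t))"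
    by (intro integrable_character_mult mem_integrable) simp
  then show ?case by (simp flip: mult.assoc)
next
  case 2 then show ?case using zero_mem by simp
next
  case (3 f g)
  then show ?case using add_mem[of "\<lambda>t. character w t * f t" "\<lambda>t. character w t * g t"]
    by (simp add: distrib_left)
next
  case (4 f c)
  then show ?case using cmult_mem[of "\<lambda>t. character w t * f t" c] by (simp add: mult.left_commute)
next
  case (5 f)
  have "(\<lambda>t. character w t * f t) \<in> D"
  proof (rule closure_mem[OF integrable_character_mult[OF 5(1)]])
    fix e :: real assume "e > 0"
    then obtain g where g: "(\<lambda>t. character w t * g t) \<in> D" "L1_norm (\<lambda>x. f x - g x) < e"
      using 5(2) by auto
    moreover have "L1_norm (\<lambda>x. character w x * f x - character w x * g x) = L1_norm (\<lambda>x. f x - g x)"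
      using L1_norm_character_mult[of w "\<lambda>x. f x - g x"] by (simp add: right_diff_distrib)
    ultimately show "\<exists>i\<in>D. L1_norm (\<lambda>x. character w x * f x - i x) < e"
      by (intro bexI[where x="\<lambda>t. character w t * g t"]) simp_all
  qed
  then show ?case by simp
next
  case (6 f a)
  have "(\<lambda>t. character w (- a) * (character w (t + a) * f (t + a))) \<in> D"
    using cmult_mem[OF translate_mem] 6 by simp
  moreover have "character w (- a) * (character w (t + a) * f (t + a)) = character w t * f (t + a)" for t
    by (simp flip: mult.assoc character_add)
  ultimately show ?case by simp
qed

lemma tent_kernel_mem_near:
  assumes f: "f \<in> D" and w: "fourier f w \<noteq> 0"
  shows "\<exists>r>0. \<forall>b d. 0 < d \<and> \<bar>b - w\<bar> + d \<le> r \<longrightarrow> tent_kernel b d \<in> D"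
proof -
  interpret M: L1_closed_ideal "{f. (\<lambda>t. character w t * f t) \<in> D}" by (rule modulated)
  have m: "(\<lambda>t. character (- w) t * f t) \<in> {f. (\<lambda>t. character w t * f t) \<in> D}"
  proof -
    have "character w t * (character (- w) t * f t) = f t" for t
      using character_minus_mult[of "- w" t] by (simp flip: mult.assoc)
    then show ?thesis using f by (simp only: mem_Collect_eq)
  qed
  have "(LINT t|lborel. character (- w) t * f t) \<noteq> 0"
    using w mem_integrable[OF f] by (simp add: fourier_lborel)
  from M.tent_kernel_mem_near_0[OF m this] obtain r where r: "r > 0"
    "\<And>b d. 0 < d \<Longrightarrow> \<bar>b\<bar> + d \<le> r \<Longrightarrow> (\<lambda>t. character w t * tent_kernel b d t) \<in> D" by auto
  have "(\<lambda>t. character w t * tent_kernel (b - w) d t) = tent_kernel b d" for b d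
    using character_add_freq[of w "b - w"] by (simp add: tent_kernel_def fun_eq_iff)
  with r(2)[of _ "b - w" for b] r(1) show ?thesis by (intro exI[of _ r]) simp
qed

lemma tent_kernel_refine_mem:
  assumes "tent_kernel (b - d/2) (d/2) \<in> D" "tent_kernel b (d/2) \<in> D" "tent_kernel (b + d/2) (d/2) \<in> D"
  shows "tent_kernel b d \<in> D"
  using assms unfolding tent_kernel_refine[of b d, abs_def] by (intro add_mem cmult_mem)

text \<open>
  The half-widths admitted by local inversion are bounded below on a compact set (Lebesgue number).
  Wider tents follow by refinement, since the three parts of a tent are supported inside its support.
\<close>
lemma tent_kernel_mem:
  assumes d: "0 < d" and ex: "\<And>u. \<bar>u - b\<bar> \<le> d \<Longrightarrow> \<exists>f\<in>D. fourier f u \<noteq> 0"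
  shows "tent_kernel b d \<in> D"
proof -
  let ?K = "{b - d..b + d}"
  have "\<forall>u\<in>?K. \<exists>r>0. \<forall>c e. 0 < e \<and> \<bar>c - u\<bar> + e \<le> r \<longrightarrow> tent_kernel c e \<in> D"
  proof
    fix u assume "u \<in> ?K"
    then have "\<bar>u - b\<bar> \<le> d" by auto
    then show "\<exists>r>0. \<forall>c e. 0 < e \<and> \<bar>c - u\<bar> + e \<le> r \<longrightarrow> tent_kernel c e \<in> D"
      using ex tent_kernel_mem_near by blast
  qed
  then obtain r where r: "\<And>u. u \<in> ?K \<Longrightarrow> r u > 0"
    "\<And>u c e. u \<in> ?K \<Longrightarrow> 0 < e \<Longrightarrow> \<bar>c - u\<bar> + e \<le> r u \<Longrightarrow> tent_kernel c e \<in> D"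
    by metis
  obtain q where q: "q > 0" "\<And>x. x \<in> ?K \<Longrightarrow> \<exists>G\<in>(\<lambda>u. ball u (r u)) ` ?K. ball x q \<subseteq> G"
    by (rule Heine_Borel_lemma[of ?K "(\<lambda>u. ball u (r u)) ` ?K"]) (use r(1) in force)+
  have small: "tent_kernel c e \<in> D" if c: "c \<in> ?K" and e: "0 < e" "e < q" for c e
  proof -
    obtain u where u: "u \<in> ?K" "ball c q \<subseteq> ball u (r u)" using q(2)[OF c] by auto
    have "c + e \<in> ball c q" "c - e \<in> ball c q" using e by (auto simp: dist_real_def)
    then have "c + e \<in> ball u (r u)" "c - e \<in> ball u (r u)" using u(2) by blast+
    then show ?thesis using e by (intro r(2)[OF u(1)]) (auto simp: dist_real_def)
  qed
  have "tent_kernel c e \<in> D" if "0 < e" "e < 2 ^ n * q" "{c - e..c + e} \<subseteq> ?K" for n c e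
    using that
  proof (induction n arbitrary: c e)
    case 0 then show ?case by (intro small) auto
  next
    case (Suc n)
    have sub: "{c - e/2 - e/2..c - e/2 + e/2} \<subseteq> ?K" "{c - e/2..c + e/2} \<subseteq> ?K" "{c + e/2 - e/2..c + e/2 + e/2} \<subseteq> ?K"
      using Suc.prems by auto
    show ?case
      by (rule tent_kernel_refine_mem; rule Suc.IH) (use Suc.prems sub in auto)
  qed
  moreover obtain n where "d / q < 2 ^ n" using real_arch_pow[of 2 "d / q"] by auto
  ultimately show ?thesis using d q(1) by (simp add: pos_divide_less_eq)
qed

text \<open>
  Here the closed support contains \<open>0\<close>, where nothing is known. Of the three parts in a refinement only
  the one touching \<open>0\<close> is problematic, and it carries the factor \<open>1/2\<close>. Iteration leaves \<open>2^-n\<close> times a kernel of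
  constant norm.
\<close>
lemma tent_kernel_touching_0_mem:
  assumes a: "0 < a" and s: "s = 1 \<or> s = -1"
    and ex: "\<And>u. u \<noteq> 0 \<Longrightarrow> \<bar>u\<bar> \<le> 2 * a \<Longrightarrow> \<exists>f\<in>D. fourier f u \<noteq> 0"
  shows "tent_kernel (s * a) a \<in> D"
proof -
  have step: "(\<lambda>t. tent_kernel (s * c) c t - 1/2 * tent_kernel (s * (c/2)) (c/2) t) \<in> D" if c: "0 < c" "c \<le> a" for c
  proof -
    have m: "tent_kernel (s * c) (c/2) \<in> D" "tent_kernel (s * (3 * c / 2)) (c/2) \<in> D"
      by (rule tent_kernel_mem; use c s in \<open>force intro!: ex simp: abs_if split: if_splits\<close>)+
    have "(\<lambda>t. tent_kernel (s * c) c t - 1/2 * tent_kernel (s * (c/2)) (c/2) t)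
        = (\<lambda>t. tent_kernel (s * c) (c/2) t + 1/2 * tent_kernel (s * (3 * c / 2)) (c/2) t)"
      using s tent_kernel_refine[of "s * c" c] by (auto simp: fun_eq_iff field_simps)
    then show ?thesis by (simp only:) (intro add_mem cmult_mem m)
  qed
  have iter: "(\<lambda>t. tent_kernel (s * a) a t - 1 / 2 ^ n * tent_kernel (s * (a / 2 ^ n)) (a / 2 ^ n) t) \<in> D" for n
  proof (induction n)
    case 0 then show ?case using zero_mem by simp
  next
    case (Suc n)
    have "a / 2 ^ n \<le> a" using a by (simp add: divide_le_eq mult_le_cancel_left1)
    from add_mem[OF Suc cmult_mem[OF step[OF _ this], of "1 / 2 ^ n"]]
    show ?case using a by (simp add: right_diff_distrib mult.commute)
  qed
  show ?thesis
  proof (rule closure_mem[OF integrable_tent_kernel[OF a]])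
    fix e :: real assume e: "e > 0"
    let ?N = "L1_norm (\<lambda>x. complex_of_real (fejer x))"
    obtain n where n: "?N / e < 2 ^ n" using real_arch_pow[of 2 "?N / e"] by auto
    have "L1_norm (\<lambda>t. 1 / 2 ^ n * tent_kernel (s * (a / 2 ^ n)) (a / 2 ^ n) t) = ?N / 2 ^ n"
      unfolding L1_norm_cmult using a by (simp add: L1_norm_tent_kernel norm_divide norm_power)
    also have "\<dots> < e" using n e by (simp add: field_simps)
    finally show "\<exists>g\<in>D. L1_norm (\<lambda>x. tent_kernel (s * a) a x - g x) < e"
      by (intro bexI[OF _ iter[of n]]) simp
  qed
qed

text \<open>
  Refinement of the tent at \<open>0\<close> splits off two tents that touch \<open>0\<close>, so modulo the ideal its width may be
  halved indefinitely. A wide kernel is almost invariant under the fixed translation \<open>h\<close>.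
\<close>
lemma difference_tent_kernel_mem:
  assumes a: "0 < a" and ex: "\<And>u. u \<noteq> 0 \<Longrightarrow> \<bar>u\<bar> \<le> a \<Longrightarrow> \<exists>f\<in>D. fourier f u \<noteq> 0"
  shows "(\<lambda>t. tent_kernel 0 a (t + h) - tent_kernel 0 a t) \<in> D"
proof -
  have step: "(\<lambda>t. tent_kernel 0 c t - tent_kernel 0 (c/2) t) \<in> D" if c: "0 < c" "c \<le> a" for c
  proof -
    have "tent_kernel (s * (c/2)) (c/2) \<in> D" if "s = 1 \<or> s = -1" for s
      by (rule tent_kernel_touching_0_mem[OF _ that]) (use c ex in auto)
    from this[of 1] this[of "-1"]
    have "(\<lambda>t. 1/2 * tent_kernel (0 - c/2) (c/2) t + 1/2 * tent_kernel (0 + c/2) (c/2) t) \<in> D"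
      by (intro add_mem cmult_mem) auto
    moreover have "(\<lambda>t. tent_kernel 0 c t - tent_kernel 0 (c/2) t)
      = (\<lambda>t. 1/2 * tent_kernel (0 - c/2) (c/2) t + 1/2 * tent_kernel (0 + c/2) (c/2) t)"
      using tent_kernel_refine[of 0 c] by (simp add: fun_eq_iff)
    ultimately show ?thesis by simp
  qed
  have iter: "(\<lambda>t. tent_kernel 0 a t - tent_kernel 0 (a / 2 ^ n) t) \<in> D" for n
  proof (induction n)
    case 0 then show ?case using zero_mem by simp
  next
    case (Suc n)
    have "a / 2 ^ n \<le> a" using a by (simp add: divide_le_eq mult_le_cancel_left1)
    from add_mem[OF Suc step[OF _ this]] show ?case using a by (simp add: mult.commute)
  qed
  let ?K = "\<lambda>x. complex_of_real (fejer x)"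
  have K: "integrable lborel ?K" by (intro integrable_of_real integrable_fejer)
  have N: "L1_norm (\<lambda>t. tent_kernel 0 d (t + h) - tent_kernel 0 d t) = L1_norm (\<lambda>x. ?K (x + d * h) - ?K x)"
    if "d > 0" for d
    using L1_norm_dilate[OF that, of "\<lambda>x. ?K (x + d * h) - ?K x"]
    by (simp add: tent_kernel_def right_diff_distrib distrib_left)
  have "(\<lambda>n. a * h * (1 / 2) ^ n) \<longlonglongrightarrow> a * h * 0"
    by (intro tendsto_intros LIMSEQ_realpow_zero) auto
  then have "(\<lambda>n. a / 2 ^ n * h) \<longlonglongrightarrow> 0" by (simp add: power_one_over field_simps)
  from isCont_tendsto_compose[OF L1_translation_isCont[OF K] this]
  have lim: "(\<lambda>n. L1_norm (\<lambda>x. ?K (x + a / 2 ^ n * h) - ?K x)) \<longlonglongrightarrow> 0" by (simp add: L1_norm_def)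
  show ?thesis
  proof (rule closure_mem)
    show "integrable lborel (\<lambda>t. tent_kernel 0 a (t + h) - tent_kernel 0 a t)"
      by (intro Bochner_Integration.integrable_diff integrable_translate integrable_tent_kernel a)
    fix e :: real assume "e > 0"
    from order_tendstoD(2)[OF lim this]
    obtain n where n: "L1_norm (\<lambda>x. ?K (x + a / 2 ^ n * h) - ?K x) < e"
      using eventually_happens'[OF sequentially_bot] by blast
    let ?g = "\<lambda>t. (tent_kernel 0 a (t + h) - tent_kernel 0 (a / 2 ^ n) (t + h))
        - (tent_kernel 0 a t - tent_kernel 0 (a / 2 ^ n) t)"
    have "?g \<in> D" by (intro diff_mem iter translate_mem[OF iter])
    moreover have "L1_norm (\<lambda>t. tent_kernel 0 a (t + h) - tent_kernel 0 a t - ?g t) < e"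
      using n N[of "a / 2 ^ n"] a by simp
    ultimately show "\<exists>g\<in>D. L1_norm (\<lambda>t. tent_kernel 0 a (t + h) - tent_kernel 0 a t - g t) < e"
      by (intro bexI)
  qed
qed

end

lemma integral_tent_kernel_0: "a > 0 \<Longrightarrow> (LINT t|lborel. tent_kernel 0 a t) \<noteq> 0"
proof -
  assume a: "a > 0"
  have "(LINT t|lborel. tent_kernel 0 a t) = complex_of_real (LINT t|lborel. a * fejer (a * t))"
    by (simp add: tent_kernel_def flip: integral_complex_of_real)
  also have "(LINT t|lborel. a * fejer (a * t)) = (LINT t|lborel. fejer t)"
    using a lborel_integral_real_affine[of a fejer 0] by simp
  finally show ?thesis using fejer_integral_pos by simp
qed

section \<open>Bochner integrals in complex Banach spaces\<close>

abbreviation "simple_bintegrable \<equiv> Bochner_Integration.simple_bochner_integrable"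
abbreviation "simple_bint \<equiv> Bochner_Integration.simple_bochner_integral"

lemma bounded_bilinear_scaleC: "bounded_bilinear ((*\<^sub>C) :: complex \<Rightarrow> 'a::complex_banach \<Rightarrow> 'a)"
proof
  fix r :: real and c :: complex and x :: 'a
  show "(r *\<^sub>R c) *\<^sub>C x = r *\<^sub>R (c *\<^sub>C x)"
    by (simp add: scaleR_conv_of_real scaleC_scaleC flip: scaleC_of_real)
  show "c *\<^sub>C (r *\<^sub>R x) = r *\<^sub>R (c *\<^sub>C x)"
    by (simp add: scaleC_scaleC mult.commute flip: scaleC_of_real)
  show "\<exists>K. \<forall>a b. norm (a *\<^sub>C (b::'a)) \<le> norm a * norm b * K"
    by (intro exI[of _ 1]) (simp add: norm_scaleC)
qed (simp_all add: scaleC_add_left scaleC_add_right)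

interpretation scaleC: bounded_bilinear "(*\<^sub>C) :: complex \<Rightarrow> 'a::complex_banach \<Rightarrow> 'a"
  by (rule bounded_bilinear_scaleC)

lemma scaleC_one [simp]: "1 *\<^sub>C x = x"
  using scaleC_of_real[of 1 x] by simp

lemma borel_measurable_continuous_compose:
  fixes f :: "'m \<Rightarrow> 'a::topological_space" and g :: "'a \<Rightarrow> 'b::topological_space"
  assumes "f \<in> borel_measurable M" "continuous_on UNIV g"
  shows "(\<lambda>x. g (f x)) \<in> borel_measurable M"
  by (rule measurable_compose[OF assms(1) borel_measurable_continuous_onI[OF assms(2)]])

text \<open>
  A simple function has finite range, so the difference is measurable even when the space is not
  separable.
\<close>
lemma borel_measurable_norm_diff_simple:
  fixes f :: "'m \<Rightarrow> 'a::real_normed_vector"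
  assumes f: "f \<in> borel_measurable M" and s: "simple_function M s"
  shows "(\<lambda>y. ennreal (norm (f y - s y))) \<in> borel_measurable M"
proof (rule measurable_compose_countable'[where f="\<lambda>i y. ennreal (norm (f y - i))" and g=s and I="s ` space M"])
  show "(\<lambda>y. ennreal (norm (f y - i))) \<in> borel_measurable M" for i
  proof -
    have "(\<lambda>y. norm (f y - i)) \<in> borel_measurable M"
      by (rule borel_measurable_continuous_compose[OF f]) (intro continuous_intros)
    then show ?thesis by measurable
  qed
  show "s \<in> measurable M (count_space (s ` space M))"
    using s by (auto simp: simple_function_def intro!: measurable_count_space_extend measurable_count_space_eq2[THEN iffD2])
  show "countable (s ` space M)" using s by (auto simp: simple_function_def intro: countable_finite)
qed

lemma simple_bochner_integrableD:
  "simple_bintegrable M s \<Longrightarrow> simple_function M s"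
  by (auto elim: simple_bochner_integrable.cases)

lemma simple_bochner_integral_norm_le:
  fixes s :: "'m \<Rightarrow> 'a::real_normed_vector"
  assumes s: "simple_bintegrable M s"
  shows "ennreal (norm (simple_bint M s)) \<le> (\<integral>\<^sup>+y. norm (s y) \<partial>M)"
proof -
  have "simple_bintegrable M (\<lambda>x. norm (s x))"
    using simple_bochner_integrable_compose2[of "\<lambda>x y. norm x" M s s] s by simp
  then have "ennreal (simple_bint M (\<lambda>x. norm (s x))) = (\<integral>\<^sup>+y. norm (s y) \<partial>M)"
    by (rule simple_bochner_integral_eq_nn_integral) simp
  moreover have "norm (simple_bint M s) \<le> simple_bint M (\<lambda>x. norm (s x))"
    by (rule simple_bochner_integral_norm_bound[OF s])
  ultimately show ?thesis by (metis ennreal_leI)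
qed

lemma nn_integral_norm_le_approx:
  fixes f :: "'m \<Rightarrow> 'a::real_normed_vector"
  assumes f: "f \<in> borel_measurable M" and s: "simple_function M s"
  shows "(\<integral>\<^sup>+y. norm (s y) \<partial>M) \<le> (\<integral>\<^sup>+y. norm (f y) \<partial>M) + (\<integral>\<^sup>+y. norm (f y - s y) \<partial>M)"
proof -
  have nf: "(\<lambda>y. ennreal (norm (f y))) \<in> borel_measurable M"
    using borel_measurable_norm_diff_simple[OF f simple_function_const[of M 0]] by simp
  have "(\<integral>\<^sup>+y. norm (s y) \<partial>M) \<le> (\<integral>\<^sup>+y. ennreal (norm (f y)) + norm (f y - s y) \<partial>M)"
  proof (rule nn_integral_mono)
    fix y
    have "norm (s y) \<le> norm (f y) + norm (f y - s y)"
      using norm_triangle_ineq4[of "f y" "f y - s y"] by simp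
    then show "ennreal (norm (s y)) \<le> ennreal (norm (f y)) + norm (f y - s y)"
      by (simp flip: ennreal_plus)
  qed
  also have "\<dots> = (\<integral>\<^sup>+y. norm (f y) \<partial>M) + (\<integral>\<^sup>+y. norm (f y - s y) \<partial>M)"
    by (rule nn_integral_add[OF nf borel_measurable_norm_diff_simple[OF f s]])
  finally show ?thesis .
qed

lemma simple_bochner_integral_diff_le_approx:
  fixes f :: "'m \<Rightarrow> 'a::real_normed_vector"
  assumes f: "f \<in> borel_measurable M" and s: "simple_bintegrable M s" and t: "simple_bintegrable M t"
  shows "ennreal (norm (simple_bint M s - simple_bint M t))
    \<le> (\<integral>\<^sup>+y. norm (f y - s y) \<partial>M) + (\<integral>\<^sup>+y. norm (f y - t y) \<partial>M)"
proof -
  have st: "simple_bintegrable M (\<lambda>y. s y - t y)"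
    using simple_bochner_integrable_compose2[of "(-)" M s t] s t by simp
  have "ennreal (norm (simple_bint M s - simple_bint M t))
      \<le> (\<integral>\<^sup>+y. norm (s y - t y) \<partial>M)"
    using simple_bochner_integral_norm_le[OF st] simple_bochner_integral_diff[OF s t] by simp
  also have "\<dots> \<le> (\<integral>\<^sup>+y. ennreal (norm (f y - s y)) + norm (f y - t y) \<partial>M)"
  proof (rule nn_integral_mono)
    fix y
    have "norm (s y - t y) \<le> norm (f y - s y) + norm (f y - t y)"
      using norm_triangle_ineq4[of "f y - t y" "f y - s y"] by simp
    then show "ennreal (norm (s y - t y)) \<le> ennreal (norm (f y - s y)) + norm (f y - t y)"
      by (simp flip: ennreal_plus)
  qed
  also have "\<dots> = (\<integral>\<^sup>+y. norm (f y - s y) \<partial>M) + (\<integral>\<^sup>+y. norm (f y - t y) \<partial>M)"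
    using s t by (intro nn_integral_add borel_measurable_norm_diff_simple f simple_bochner_integrableD)
  finally show ?thesis .
qed

lemma has_bint_norm_le:
  assumes "has_bint M f x"
  shows "ennreal (norm x) \<le> (\<integral>\<^sup>+y. norm (f y) \<partial>M)"
proof -
  obtain s where f: "f \<in> borel_measurable M" and s: "\<And>i. simple_bintegrable M (s i)"
    and l: "(\<lambda>i. \<integral>\<^sup>+y. norm (f y - s i y) \<partial>M) \<longlonglongrightarrow> 0" "(\<lambda>i. simple_bint M (s i)) \<longlonglongrightarrow> x"
    using assms unfolding has_bint_def by blast
  have 1: "(\<lambda>i. ennreal (norm (simple_bint M (s i)))) \<longlonglongrightarrow> ennreal (norm x)"
    by (intro tendsto_ennrealI tendsto_norm l)
  have 2: "(\<lambda>i. (\<integral>\<^sup>+y. norm (f y) \<partial>M) + (\<integral>\<^sup>+y. norm (f y - s i y) \<partial>M)) \<longlonglongrightarrow> (\<integral>\<^sup>+y. norm (f y) \<partial>M) + 0"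
    by (intro tendsto_add tendsto_const l)
  have 3: "ennreal (norm (simple_bint M (s i)))
      \<le> (\<integral>\<^sup>+y. norm (f y) \<partial>M) + (\<integral>\<^sup>+y. norm (f y - s i y) \<partial>M)" for i
    using simple_bochner_integral_norm_le[OF s, of i]
      nn_integral_norm_le_approx[OF f simple_bochner_integrableD[OF s], of i] by (rule order_trans)
  from LIMSEQ_le[OF 1 2] 3 have "ennreal (norm x) \<le> (\<integral>\<^sup>+y. norm (f y) \<partial>M) + 0"
    by blast
  then show ?thesis by simp
qed

lemma has_bint_zero: "has_bint M (\<lambda>_. 0 :: 'a::real_normed_vector) 0"
proof -
  have "simple_bintegrable M (\<lambda>_. 0 :: 'a)" by (auto intro: simple_bochner_integrable.intros)
  moreover have "simple_bint M (\<lambda>_. 0 :: 'a) = 0"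
    by (auto simp: simple_bochner_integral_def intro!: sum.neutral)
  ultimately show ?thesis unfolding has_bint_def
    by (intro conjI exI[of _ "\<lambda>i _. 0"]) auto
qed

text \<open>
  In a nonseparable space sums of Borel functions need not be Borel, hence the hypothesis on
  \<open>h\<close>. Equality almost everywhere lets the same lemma serve for uniqueness of the integral and for changes on null sets.
\<close>
lemma has_bint_add_scaleC:
  fixes f :: "'m \<Rightarrow> 'a::complex_banach"
  assumes f: "has_bint M f x" and g: "has_bint M g y" and h: "h \<in> borel_measurable M"
    and eq: "AE z in M. h z = f z + c *\<^sub>C g z"
  shows "has_bint M h (x + c *\<^sub>C y)"
proof -
  obtain s where fm: "f \<in> borel_measurable M" and s: "\<And>i. simple_bintegrable M (s i)"
    and sl: "(\<lambda>i. \<integral>\<^sup>+y. norm (f y - s i y) \<partial>M) \<longlonglongrightarrow> 0" "(\<lambda>i. simple_bint M (s i)) \<longlonglongrightarrow> x"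
    using f unfolding has_bint_def by blast
  obtain t where gm: "g \<in> borel_measurable M" and t: "\<And>i. simple_bintegrable M (t i)"
    and tl: "(\<lambda>i. \<integral>\<^sup>+y. norm (g y - t i y) \<partial>M) \<longlonglongrightarrow> 0" "(\<lambda>i. simple_bint M (t i)) \<longlonglongrightarrow> y"
    using g unfolding has_bint_def by blast
  define r where "r i z = s i z + c *\<^sub>C t i z" for i z
  have ct: "simple_bintegrable M (\<lambda>z. c *\<^sub>C t i z)" for i
    using simple_bochner_integrable_compose2[of "\<lambda>x y. c *\<^sub>C y" M "s i" "t i"] s t
    by (simp add: scaleC.zero_right)
  have r: "simple_bintegrable M (r i)" for i
    using simple_bochner_integrable_compose2[of "\<lambda>x y. x + c *\<^sub>C y" M "s i" "t i"] s t
    by (simp add: r_def[abs_def] scaleC.zero_right)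
  have "linear ((*\<^sub>C) c :: 'a \<Rightarrow> 'a)"
    using scaleC.bounded_linear_right bounded_linear.linear by blast
  then have ri: "simple_bint M (r i) = simple_bint M (s i) + c *\<^sub>C simple_bint M (t i)" for i
    unfolding r_def[abs_def] simple_bochner_integral_add[OF s ct]
    by (simp add: simple_bochner_integral_linear[OF _ t])
  have "(\<lambda>i. simple_bint M (r i)) \<longlonglongrightarrow> x + c *\<^sub>C y"
    unfolding ri by (intro tendsto_add scaleC.tendsto tendsto_const sl tl)
  moreover have "(\<lambda>i. \<integral>\<^sup>+z. norm (h z - r i z) \<partial>M) \<longlonglongrightarrow> 0"
  proof (rule tendsto_sandwich[OF _ _ tendsto_const])
    show "(\<lambda>i. (\<integral>\<^sup>+z. norm (f z - s i z) \<partial>M) + ennreal (norm c) * (\<integral>\<^sup>+z. norm (g z - t i z) \<partial>M)) \<longlonglongrightarrow> 0"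
      using tendsto_add[OF sl(1) ennreal_tendsto_cmult[OF _ tl(1), of "ennreal (norm c)"]] by simp
    have "(\<integral>\<^sup>+z. norm (h z - r i z) \<partial>M) \<le> (\<integral>\<^sup>+z. ennreal (norm (f z - s i z)) + ennreal (norm c) * norm (g z - t i z) \<partial>M)" for i
    proof (rule nn_integral_mono_AE)
      show "AE z in M. ennreal (norm (h z - r i z)) \<le> ennreal (norm (f z - s i z)) + ennreal (norm c) * norm (g z - t i z)"
        using eq
      proof eventually_elim
        case (elim z)
        have "h z - r i z = (f z - s i z) + c *\<^sub>C (g z - t i z)"
          by (simp add: elim r_def scaleC.diff_right)
        then have "norm (h z - r i z) \<le> norm (f z - s i z) + norm c * norm (g z - t i z)"
          using norm_triangle_ineq[of "f z - s i z" "c *\<^sub>C (g z - t i z)"] by (simp add: norm_scaleC)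
        then show ?case by (simp flip: ennreal_plus ennreal_mult)
      qed
    qed
    also have "(\<integral>\<^sup>+z. ennreal (norm (f z - s i z)) + ennreal (norm c) * norm (g z - t i z) \<partial>M)
       = (\<integral>\<^sup>+z. norm (f z - s i z) \<partial>M) + ennreal (norm c) * (\<integral>\<^sup>+z. norm (g z - t i z) \<partial>M)" for i
      using borel_measurable_norm_diff_simple[OF fm simple_bochner_integrableD[OF s], of i]
        borel_measurable_norm_diff_simple[OF gm simple_bochner_integrableD[OF t], of i]
      by (subst nn_integral_add) (auto simp: nn_integral_cmult)
    finally show "\<forall>\<^sub>F i in sequentially. (\<integral>\<^sup>+z. norm (h z - r i z) \<partial>M)
       \<le> (\<integral>\<^sup>+z. norm (f z - s i z) \<partial>M) + ennreal (norm c) * (\<integral>\<^sup>+z. norm (g z - t i z) \<partial>M)"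
      by (intro always_eventually allI)
  qed simp
  ultimately show ?thesis unfolding has_bint_def using h r by blast
qed

lemma has_bint_unique:
  fixes f :: "'m \<Rightarrow> 'a::complex_banach"
  assumes "has_bint M f x" "has_bint M f y"
  shows "x = y"
proof -
  have m: "(- 1) *\<^sub>C z = - z" for z :: 'a
    using scaleC_of_real[of "- 1" z] by simp
  have "has_bint M (\<lambda>_. 0 :: 'a) (x + (- 1) *\<^sub>C y)"
    by (rule has_bint_add_scaleC[OF assms]) (simp_all add: m)
  from has_bint_norm_le[OF this] show ?thesis by (simp add: m)
qed

lemma bint_eqI:
  fixes f :: "'m \<Rightarrow> 'a::complex_banach"
  assumes "has_bint M f x" shows "bint M f = x"
  using assms has_bint_unique unfolding bint_def bintegrable_def by (auto intro!: the_equality)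

text \<open>
  Domination makes the integrals of the approximants a Cauchy sequence; completeness gives the value.
\<close>
lemma has_bint_dominated:
  fixes h :: "'m \<Rightarrow> 'a::complex_banach"
  assumes h: "h \<in> borel_measurable M" and s: "\<And>i::nat. simple_function M (s i)"
    and lim: "AE x in M. (\<lambda>i. s i x) \<longlonglongrightarrow> h x"
    and w: "integrable M w" and bd: "\<And>i. AE x in M. norm (s i x) \<le> w x"
  shows "\<exists>x. has_bint M h x"
proof -
  have wfin: "(\<integral>\<^sup>+x. ennreal (w x) \<partial>M) < \<infinity>"
    using w integrableD(2) by (metis infinity_ennreal_def less_top real_integrable_def)
  have wm: "(\<lambda>x. ennreal (w x)) \<in> borel_measurable M" using w by measurable
  have sb: "simple_bintegrable M (s i)" for i
  proof (rule simple_bochner_integrableI_bounded[OF s])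
    have "(\<integral>\<^sup>+x. norm (s i x) \<partial>M) \<le> (\<integral>\<^sup>+x. ennreal (w x) \<partial>M)"
      by (rule nn_integral_mono_AE) (use bd[of i] in \<open>auto elim!: eventually_mono intro!: ennreal_leI\<close>)
    then show "(\<integral>\<^sup>+x. norm (s i x) \<partial>M) < \<infinity>" using wfin by (rule le_less_trans)
  qed
  let ?a = "\<lambda>i. \<integral>\<^sup>+x. norm (h x - s i x) \<partial>M"
  have hb: "AE x in M. norm (h x) \<le> w x"
  proof -
    have "AE x in M. \<forall>i. norm (s i x) \<le> w x" using bd by (simp add: AE_all_countable)
    with lim show ?thesis
    proof eventually_elim
      case (elim x)
      then show ?case by (intro LIMSEQ_le_const2[OF tendsto_norm[OF elim(1)]]) auto
    qed
  qed
  have a: "?a \<longlonglongrightarrow> (\<integral>\<^sup>+x. 0 \<partial>M)"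
  proof (rule nn_integral_dominated_convergence[where w="\<lambda>x. ennreal (2 * w x)"])
    show "(\<lambda>x. ennreal (norm (h x - s i x))) \<in> borel_measurable M" for i
      by (rule borel_measurable_norm_diff_simple[OF h s])
    show "AE x in M. ennreal (norm (h x - s i x)) \<le> ennreal (2 * w x)" for i
      using hb bd[of i]
    proof eventually_elim
      case (elim x)
      then show ?case using norm_triangle_ineq4[of "h x" "s i x"] by (intro ennreal_leI) simp
    qed
    show "AE x in M. (\<lambda>i. ennreal (norm (h x - s i x))) \<longlonglongrightarrow> 0"
      using lim
    proof eventually_elim
      case (elim x)
      have "(\<lambda>i. ennreal (norm (h x - s i x))) \<longlonglongrightarrow> ennreal (norm (h x - h x))"
        by (intro tendsto_ennrealI tendsto_norm tendsto_diff tendsto_const elim)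
      then show ?case by simp
    qed
    have "integrable M (\<lambda>x. 2 * w x)" using w by simp
    then show "(\<integral>\<^sup>+x. ennreal (2 * w x) \<partial>M) < \<infinity>"
      by (metis infinity_ennreal_def less_top real_integrable_def)
  qed (use w in auto)
  then have a: "?a \<longlonglongrightarrow> 0" by simp
  have "Cauchy (\<lambda>i. simple_bint M (s i))"
  proof (rule metric_CauchyI)
    fix e :: real assume "e > 0"
    then have "ennreal (e / 2) > 0" by simp
    from order_tendstoD(2)[OF a this] obtain N where N: "\<And>i. i \<ge> N \<Longrightarrow> ?a i < ennreal (e / 2)"
      by (auto simp: eventually_sequentially)
    have "dist (simple_bint M (s i)) (simple_bint M (s j)) < e"
      if "i \<ge> N" "j \<ge> N" for i j
    proof -
      have "ennreal (norm (simple_bint M (s i) - simple_bint M (s j))) \<le> ?a i + ?a j"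
        by (rule simple_bochner_integral_diff_le_approx[OF h sb sb])
      also have "\<dots> < ennreal (e / 2) + ennreal (e / 2)"
        by (intro add_strict_mono N that)
      also have "\<dots> = ennreal e" using \<open>e > 0\<close> by (simp flip: ennreal_plus)
      finally show ?thesis by (simp add: dist_norm ennreal_less_iff)
    qed
    then show "\<exists>N. \<forall>i\<ge>N. \<forall>j\<ge>N. dist (simple_bint M (s i)) (simple_bint M (s j)) < e"
      by blast
  qed
  then obtain x where "(\<lambda>i. simple_bint M (s i)) \<longlonglongrightarrow> x"
    using Cauchy_convergent_iff convergent_def by blast
  then show ?thesis unfolding has_bint_def using h sb a by blast
qed

lemma has_bint_measure_preserving:
  fixes g :: "'m \<Rightarrow> 'a::real_normed_vector"
  assumes g: "has_bint M g x" and T: "T \<in> measurable M M" and pres: "distr M M T = M"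
    and surj: "T ` space M = space M"
  shows "has_bint M (\<lambda>y. g (T y)) x"
proof -
  obtain s where gm: "g \<in> borel_measurable M" and s: "\<And>i. simple_bintegrable M (s i)"
    and sl: "(\<lambda>i. \<integral>\<^sup>+y. norm (g y - s i y) \<partial>M) \<longlonglongrightarrow> 0" "(\<lambda>i. simple_bint M (s i)) \<longlonglongrightarrow> x"
    using g unfolding has_bint_def by blast
  have sf: "simple_function M (\<lambda>y. s i (T y))" for i
    by (rule simple_function_comp[OF T simple_bochner_integrableD[OF s]])
  have sm: "{z \<in> space M. P (s i z)} \<in> sets M" for i P
    using simple_bochner_integrableD[OF s, of i] 
    by (rule simple_functionD(2)[where X="Collect P", THEN back_subst[where P="\<lambda>A. A \<in> sets M"]]) auto
  have vim: "T -` {z \<in> space M. P (s i z)} \<inter> space M = {z \<in> space M. P (s i (T z))}" for i P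
    using measurable_space[OF T] by auto
  have em: "emeasure M {z \<in> space M. P (s i (T z))} = emeasure M {z \<in> space M. P (s i z)}" for i P
    using emeasure_distr[OF T, of "{z \<in> space M. P (s i z)}"] sm[of P i] by (simp only: pres vim)
  have si: "simple_bintegrable M (\<lambda>y. s i (T y))" for i
    using s[of i] sf[of i] em[of "\<lambda>y. y \<noteq> 0" i]
    by (auto elim!: simple_bochner_integrable.cases intro!: simple_bochner_integrable.intros)
  have im: "(\<lambda>y. s i (T y)) ` space M = s i ` space M" for i
    using surj by (metis image_image)
  have "simple_bint M (\<lambda>y. s i (T y)) = simple_bint M (s i)" for i
    unfolding simple_bochner_integral_def im measure_def using em[of "\<lambda>y. y = z" i for z] by simp
  moreover have "(\<integral>\<^sup>+y. norm (g (T y) - s i (T y)) \<partial>M) = (\<integral>\<^sup>+y. norm (g y - s i y) \<partial>M)" for i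
    using nn_integral_distr[OF T, of "\<lambda>y. ennreal (norm (g y - s i y))"]
      borel_measurable_norm_diff_simple[OF gm simple_bochner_integrableD[OF s], of i] by (simp add: pres)
  ultimately show ?thesis
    unfolding has_bint_def using sl si measurable_compose[OF T gm]
    by (intro conjI exI[of _ "\<lambda>i y. s i (T y)"]) auto
qed

lemma has_bint_restrict_space:
  fixes g :: "'m \<Rightarrow> 'a::complex_banach"
  assumes S: "S \<in> sets M" and G: "has_bint M (\<lambda>y. (indicator S y :: complex) *\<^sub>C g y) x"
  shows "has_bint (restrict_space M S) g x"
proof -
  let ?g = "\<lambda>y. (indicator S y :: complex) *\<^sub>C g y"
  obtain s where gm: "?g \<in> borel_measurable M" and s: "\<And>i. simple_bintegrable M (s i)"
    and sl: "(\<lambda>i. \<integral>\<^sup>+y. norm (?g y - s i y) \<partial>M) \<longlonglongrightarrow> 0" "(\<lambda>i. simple_bint M (s i)) \<longlonglongrightarrow> x"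
    using G unfolding has_bint_def by blast
  have SM: "S \<inter> space M \<in> sets M" using S by simp
  have sp: "space (restrict_space M S) = S" using sets.sets_into_space[OF S] by (auto simp: space_restrict_space)
  define t where "t i y = indicat_real S y *\<^sub>R s i y" for i y
  have t: "simple_bintegrable M (t i)" for i
  proof (rule simple_bochner_integrable.intros)
    show "simple_function M (t i)" unfolding t_def[abs_def]
      using simple_bochner_integrableD[OF s, of i] S
      by (intro simple_function_compose2[where h="(*\<^sub>R)"] simple_function_indicator)
    have "emeasure M {y \<in> space M. t i y \<noteq> 0} \<le> emeasure M {y \<in> space M. s i y \<noteq> 0}"
    proof (rule emeasure_mono)
      show "{y \<in> space M. s i y \<noteq> 0} \<in> sets M"
        using simple_functionD(2)[OF simple_bochner_integrableD[OF s], of i "-{0}"]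
        by (rule back_subst[where P="\<lambda>A. A \<in> sets M"]) auto
    qed (auto simp: t_def)
    then show "emeasure M {y \<in> space M. t i y \<noteq> 0} \<noteq> \<infinity>"
      using s[of i] by (auto simp: top_unique elim!: simple_bochner_integrable.cases)
  qed
  have tr: "simple_bintegrable (restrict_space M S) (s i)" for i
    using t[of i] unfolding simple_bochner_integrable_restrict_space[OF SM] t_def[abs_def] .
  have ti: "simple_bint (restrict_space M S) (s i) = simple_bint M (t i)" for i
    unfolding simple_bochner_integral_restrict_space[OF SM tr] t_def[abs_def] ..
  have le: "(\<integral>\<^sup>+y. norm (?g y - t i y) \<partial>M) \<le> (\<integral>\<^sup>+y. norm (?g y - s i y) \<partial>M)" for i
    by (intro nn_integral_mono ennreal_leI) (auto simp: t_def indicator_def scaleC.zero_left)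
  have tl: "(\<lambda>i. simple_bint M (t i)) \<longlonglongrightarrow> x"
  proof -
    have "(\<lambda>i. ennreal (norm (simple_bint M (s i) - simple_bint M (t i)))) \<longlonglongrightarrow> 0"
    proof (rule tendsto_sandwich[OF _ _ tendsto_const])
      show "(\<lambda>i. (\<integral>\<^sup>+y. norm (?g y - s i y) \<partial>M) + (\<integral>\<^sup>+y. norm (?g y - s i y) \<partial>M)) \<longlonglongrightarrow> 0"
        using tendsto_add[OF sl(1) sl(1)] by simp
      show "\<forall>\<^sub>F i in sequentially. ennreal (norm (simple_bint M (s i) - simple_bint M (t i)))
         \<le> (\<integral>\<^sup>+y. norm (?g y - s i y) \<partial>M) + (\<integral>\<^sup>+y. norm (?g y - s i y) \<partial>M)"
      proof (intro always_eventually allI)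
        fix i
        show "ennreal (norm (simple_bint M (s i) - simple_bint M (t i)))
         \<le> (\<integral>\<^sup>+y. norm (?g y - s i y) \<partial>M) + (\<integral>\<^sup>+y. norm (?g y - s i y) \<partial>M)"
          using simple_bochner_integral_diff_le_approx[OF gm s t, of i i] add_left_mono[OF le]
          by (rule order_trans)
      qed
    qed simp
    then have "(\<lambda>i. norm (simple_bint M (s i) - simple_bint M (t i))) \<longlonglongrightarrow> 0"
      by (simp add: tendsto_ennreal_iff flip: ennreal_0)
    then have "(\<lambda>i. simple_bint M (s i) - simple_bint M (t i)) \<longlonglongrightarrow> 0"
      by (rule tendsto_norm_zero_cancel)
    from tendsto_diff[OF sl(2) this] show ?thesis by simp
  qed
  show ?thesis unfolding has_bint_def
  proof (intro conjI exI[of _ s] allI tr)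
    have "?g \<in> borel_measurable (restrict_space M S)" using gm by (rule measurable_restrict_space1)
    then show "g \<in> borel_measurable (restrict_space M S)"
      by (rule measurable_cong[THEN iffD1, rotated]) (simp add: sp)
    show "(\<lambda>i. simple_bint (restrict_space M S) (s i)) \<longlonglongrightarrow> x" unfolding ti by (rule tl)
    show "(\<lambda>i. \<integral>\<^sup>+y. norm (g y - s i y) \<partial>restrict_space M S) \<longlonglongrightarrow> 0"
    proof (rule tendsto_sandwich[OF _ _ tendsto_const sl(1)])
      have "(\<integral>\<^sup>+y. norm (g y - s i y) \<partial>restrict_space M S) \<le> (\<integral>\<^sup>+y. norm (?g y - s i y) \<partial>M)" for i
        unfolding nn_integral_restrict_space[OF SM]
        by (intro nn_integral_mono) (auto simp: indicator_def)
      then show "\<forall>\<^sub>F i in sequentially. (\<integral>\<^sup>+y. norm (g y - s i y) \<partial>restrict_space M S) \<le> (\<integral>\<^sup>+y. norm (?g y - s i y) \<partial>M)"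
        by simp
    qed simp
  qed
qed

section \<open>Convolution of a bounded function with an integrable one\<close>

lemma
  assumes c: "\<bar>c\<bar> = (1::real)"
  shows lebesgue_reflection_measurable: "(\<lambda>x. t + c * x) \<in> measurable lebesgue lebesgue"
    and distr_lebesgue_reflection: "distr lebesgue lebesgue (\<lambda>x. t + c * x) = lebesgue"
    and range_reflection: "range (\<lambda>x. t + c * x) = UNIV"
proof -
  have c0: "c \<noteq> 0" using c by auto
  show "(\<lambda>x. t + c * x) \<in> measurable lebesgue lebesgue"
    using lebesgue_affine_measurable[of "\<lambda>_. c" t] c0 by simp
  show "distr lebesgue lebesgue (\<lambda>x. t + c * x) = lebesgue"
    using lebesgue_real_affine[OF c0, of t] c by (simp add: density_1)
  show "range (\<lambda>x. t + c * x) = UNIV"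
  proof (rule surjI)
    show "t + c * ((y - t) / c) = y" for y using c0 by simp
  qed
qed

lemma AE_lebesgue_reflection:
  assumes c: "\<bar>c\<bar> = (1::real)" and P: "AE x in lebesgue. P x"
  shows "AE s in lebesgue. P (t + c * s)"
proof (rule AE_distrD[OF lebesgue_reflection_measurable[OF c]])
  show "AE x in distr lebesgue lebesgue (\<lambda>x. t + c * x). P x"
    unfolding distr_lebesgue_reflection[OF c] by (rule P)
qed

lemma has_bint_reflection:
  assumes c: "\<bar>c\<bar> = (1::real)" and g: "has_bint lebesgue g x"
  shows "has_bint lebesgue (\<lambda>s. g (t + c * s)) x"
  by (rule has_bint_measure_preserving[OF g lebesgue_reflection_measurable[OF c] distr_lebesgue_reflection[OF c]])
    (simp add: range_reflection[OF c])

text \<open>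
  Off a null set the function agrees with a pointwise limit; completeness takes care of the
  remaining part of a preimage.
\<close>
lemma borel_measurable_completion_AE_limit:
  fixes h :: "'m \<Rightarrow> 'a::real_normed_vector"
  assumes s: "\<And>i::nat. s i \<in> borel_measurable (completion M)"
    and lim: "AE x in completion M. (\<lambda>i. s i x) \<longlonglongrightarrow> h x"
  shows "h \<in> borel_measurable (completion M)"
proof -
  obtain N where N1: "{x \<in> space (completion M). \<not> (\<lambda>i. s i x) \<longlonglongrightarrow> h x} \<subseteq> N"
    and N0: "emeasure (completion M) N = 0" and Nm: "N \<in> sets (completion M)"
    using lim by (rule AE_E)
  have N2: "N \<in> null_sets (completion M)" by (rule null_setsI[OF N0 Nm])
  define g where "g x = (if x \<in> N then 0 else h x)" for x
  have g: "g \<in> borel_measurable (completion M)"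
  proof (rule borel_measurable_LIMSEQ_metric)
    show "(\<lambda>x. if x \<in> N then 0 else s i x) \<in> borel_measurable (completion M)" for i
      using s Nm by (intro measurable_If_set) auto
    show "(\<lambda>i. if x \<in> N then 0 else s i x) \<longlonglongrightarrow> g x" if "x \<in> space (completion M)" for x
      using N1 that by (auto simp: g_def)
  qed
  show ?thesis
  proof (rule measurableI)
    fix B :: "'a set" assume B: "B \<in> sets borel"
    let ?S = "space (completion M)"
    have eq: "h -` B \<inter> ?S = ((g -` B \<inter> ?S) - N) \<union> (h -` B \<inter> ?S \<inter> N)"
      by (auto simp: g_def)
    have "h -` B \<inter> ?S \<inter> N \<in> null_sets (completion M)"
      by (rule null_sets_completion_subset[OF _ N2]) auto
    then have "((g -` B \<inter> ?S) - N) \<union> (h -` B \<inter> ?S \<inter> N) \<in> sets (completion M)"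
      by (intro sets.Un sets.Diff measurable_sets[OF g B] Nm null_setsD2)
    then show "h -` B \<inter> ?S \<in> sets (completion M)"
      by (simp only: eq[symmetric])
  qed simp
qed

text \<open>
  Products of simple approximants of \<open>f\<close> and of \<open>\<phi>\<close> are again simple. The approximants of \<open>\<phi>\<close> are cut off
  slightly above the essential bound, so that the cut-off is eventually inactive almost everywhere and the
  products are dominated.
\<close>
lemma conv_integrand:
  fixes \<phi> :: "real \<Rightarrow> 'a::complex_banach"
  assumes phi: "strongly_measurable lebesgue \<phi>" "AE t in lebesgue. norm (\<phi> t) \<le> C"
    and f: "integrable lebesgue f"
  shows "has_bint lebesgue (\<lambda>s. f s *\<^sub>C \<phi> (t - s)) (conv \<phi> f t)"
    and "norm (conv \<phi> f t) \<le> C * (LINT s|lebesgue. norm (f s))"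
proof -
  obtain \<sigma> where \<sigma>: "\<And>i. simple_function lebesgue (\<sigma> i)" "AE x in lebesgue. (\<lambda>i::nat. \<sigma> i x) \<longlonglongrightarrow> \<phi> x"
    using phi(1) unfolding strongly_measurable_def by blast
  define K where "K = max C 0 + 1"
  have K: "C < K" "0 < K" by (auto simp: K_def)
  define \<tau> where "\<tau> i x = (if norm (\<sigma> i x) \<le> K then \<sigma> i x else 0)" for i x
  have \<tau>: "simple_function lebesgue (\<tau> i)" for i
    using simple_function_compose1[OF \<sigma>(1)[of i], of "\<lambda>z. if norm z \<le> K then z else 0"] by (simp add: \<tau>_def[abs_def])
  have \<tau>_bd: "norm (\<tau> i x) \<le> K" for i x using K by (simp add: \<tau>_def)
  have "AE x in lebesgue. (\<lambda>i. \<tau> i x) \<longlonglongrightarrow> \<phi> x"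
    using \<sigma>(2) phi(2)
  proof eventually_elim
    case (elim x)
    then have "norm (\<phi> x) < K" using K by simp
    with tendsto_norm[OF elim(1)] have "\<forall>\<^sub>F i in sequentially. norm (\<sigma> i x) < K"
      by (rule order_tendstoD)
    then have "\<forall>\<^sub>F i in sequentially. \<sigma> i x = \<tau> i x"
      by eventually_elim (simp add: \<tau>_def)
    then show ?case using elim(1) by (rule Lim_transform_eventually[rotated])
  qed
  from AE_lebesgue_reflection[OF _ this, of "-1" t]
  have lim: "AE s in lebesgue. (\<lambda>i. \<tau> i (t - s)) \<longlonglongrightarrow> \<phi> (t - s)" by simp
  have \<tau>t: "simple_function lebesgue (\<lambda>s. \<tau> i (t - s))" for i
    using simple_function_comp[OF lebesgue_reflection_measurable[of "-1" t] \<tau>[of i]] by simp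
  obtain F where F: "\<And>i. simple_function lebesgue (F i)" "\<And>x. (\<lambda>i. F i x) \<longlonglongrightarrow> f x"
    "\<And>i x. norm (F i x) \<le> 2 * norm (f x)"
    using borel_measurable_implies_sequence_metric[OF borel_measurable_integrable[OF f], of 0] by auto
  let ?s = "\<lambda>i s. F i s *\<^sub>C \<tau> i (t - s)"
  let ?h = "\<lambda>s. f s *\<^sub>C \<phi> (t - s)"
  have s: "simple_function lebesgue (?s i)" for i
    by (rule simple_function_compose2[OF F(1) \<tau>t])
  have s_lim: "AE s in lebesgue. (\<lambda>i. ?s i s) \<longlonglongrightarrow> ?h s"
    using lim by eventually_elim (intro scaleC.tendsto F)
  have h: "?h \<in> borel_measurable lebesgue"
    by (rule borel_measurable_completion_AE_limit[OF borel_measurable_simple_function[OF s] s_lim])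
  have "\<exists>x. has_bint lebesgue ?h x"
  proof (rule has_bint_dominated[OF h s s_lim])
    show "integrable lebesgue (\<lambda>s. 2 * norm (f s) * K)" using f by simp
    show "AE s in lebesgue. norm (?s i s) \<le> 2 * norm (f s) * K" for i
      by (intro AE_I2) (auto simp: norm_scaleC intro!: mult_mono F \<tau>_bd)
  qed
  then show hb: "has_bint lebesgue ?h (conv \<phi> f t)"
    unfolding conv_def using bint_eqI by metis
  have phit: "AE s in lebesgue. norm (\<phi> (t - s)) \<le> C"
    using AE_lebesgue_reflection[OF _ phi(2), of "-1" t] by simp
  have C: "0 \<le> C"
  proof (rule ccontr)
    assume "\<not> 0 \<le> C"
    then have "AE t in (lebesgue::real measure). False"
      by (intro eventually_mono[OF phi(2)]) (metis norm_ge_zero order_trans)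
    then show False by (simp add: trivial_limit_def[symmetric] ae_filter_eq_bot_iff)
  qed
  have "ennreal (norm (conv \<phi> f t)) \<le> (\<integral>\<^sup>+s. norm (?h s) \<partial>lebesgue)"
    by (rule has_bint_norm_le[OF hb])
  also have "\<dots> \<le> (\<integral>\<^sup>+s. ennreal (C * norm (f s)) \<partial>lebesgue)"
  proof (rule nn_integral_mono_AE)
    show "AE s in lebesgue. ennreal (norm (?h s)) \<le> ennreal (C * norm (f s))"
      using phit by eventually_elim (auto simp: norm_scaleC mult.commute[of C] intro!: ennreal_leI mult_left_mono)
  qed
  also have "\<dots> = ennreal (LINT s|lebesgue. C * norm (f s))"
    using f C by (intro nn_integral_eq_integral) auto
  finally show "norm (conv \<phi> f t) \<le> C * (LINT s|lebesgue. norm (f s))"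
    using C by (simp add: ennreal_le_iff)
qed

lemma conv_add_cmult:
  fixes \<phi> :: "real \<Rightarrow> 'a::complex_banach"
  assumes phi: "strongly_measurable lebesgue \<phi>" "AE t in lebesgue. norm (\<phi> t) \<le> C"
    and f: "integrable lebesgue f" and g: "integrable lebesgue g"
    and h: "integrable lebesgue h" and eq: "AE s in lebesgue. h s = f s + c * g s"
  shows "conv \<phi> h t = conv \<phi> f t + c *\<^sub>C conv \<phi> g t"
proof (rule has_bint_unique)
  show "has_bint lebesgue (\<lambda>s. h s *\<^sub>C \<phi> (t - s)) (conv \<phi> h t)"
    by (rule conv_integrand(1)[OF phi h])
  then have m: "(\<lambda>s. h s *\<^sub>C \<phi> (t - s)) \<in> borel_measurable lebesgue" by (simp add: has_bint_def)
  show "has_bint lebesgue (\<lambda>s. h s *\<^sub>C \<phi> (t - s)) (conv \<phi> f t + c *\<^sub>C conv \<phi> g t)"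
    by (rule has_bint_add_scaleC[OF conv_integrand(1)[OF phi f] conv_integrand(1)[OF phi g] m])
      (use eq in \<open>auto elim!: eventually_mono simp: scaleC_add_left scaleC_scaleC\<close>)
qed

lemma conv_translate:
  fixes \<phi> :: "real \<Rightarrow> 'a::complex_banach"
  assumes phi: "strongly_measurable lebesgue \<phi>" "AE t in lebesgue. norm (\<phi> t) \<le> C"
    and f: "integrable lebesgue f"
  shows "conv \<phi> (\<lambda>s. f (s + a)) t = conv \<phi> f (t + a)"
  unfolding conv_def[of \<phi> "\<lambda>s. f (s + a)"]
proof (rule bint_eqI)
  show "has_bint lebesgue (\<lambda>s. f (s + a) *\<^sub>C \<phi> (t - s)) (conv \<phi> f (t + a))"
    using has_bint_reflection[OF _ conv_integrand(1)[OF phi f, of "t + a"], of 1 a]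
    by (simp add: add.commute)
qed

lemma integrable_lebesgue_borel_version:
  fixes f :: "real \<Rightarrow> complex"
  assumes f: "integrable lebesgue f"
  obtains g where "integrable lborel g" "integrable lebesgue g" "AE x in lebesgue. f x = g x"
proof -
  have "(\<lambda>x. Re (f x)) \<in> borel_measurable lebesgue" "(\<lambda>x. Im (f x)) \<in> borel_measurable lebesgue"
    using borel_measurable_integrable[OF f] by measurable
  from this[THEN completion_ex_borel_measurable_real]
  obtain u v where u: "u \<in> borel_measurable lborel" "AE x in lborel. Re (f x) = u x"
    and v: "v \<in> borel_measurable lborel" "AE x in lborel. Im (f x) = v x" by blast
  define g where "g x = Complex (u x) (v x)" for x
  have gm: "g \<in> borel_measurable lborel"
    using u(1) v(1) unfolding g_def[abs_def] Complex_eq by measurable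
  have ae: "AE x in lebesgue. f x = g x"
    using AE_completion[OF u(2)] AE_completion[OF v(2)]
    by eventually_elim (simp add: g_def complex_eq_iff)
  have "integrable lebesgue g"
    using f ae gm by (subst integrable_cong_AE[of g lebesgue f]) (auto simp: measurable_completion elim!: eventually_mono)
  then show thesis using that ae gm integrable_completion[of g lborel] by blast
qed

lemma fourier_AE_cong:
  assumes "integrable lebesgue f" "integrable lebesgue g" "AE x in lebesgue. f x = g x"
  shows "fourier f w = fourier g w"
proof -
  have [measurable]: "f \<in> borel_measurable lebesgue" "g \<in> borel_measurable lebesgue" using assms by auto
  have "(\<lambda>t. exp (- \<i> * complex_of_real (w * t))) \<in> borel_measurable lborel" by measurable
  from measurable_completion[OF this] show ?thesis unfolding fourier_def
    using assms(3) by (intro integral_cong_AE borel_measurable_times) (auto elim!: eventually_mono)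
qed

lemma continuous_on_fourier:
  assumes f: "integrable lebesgue f"
  shows "continuous_on UNIV (fourier f)"
proof -
  obtain g where g: "integrable lborel g" "integrable lebesgue g" "AE x in lebesgue. f x = g x"
    by (rule integrable_lebesgue_borel_version[OF f])
  have eq: "fourier f = (\<lambda>w. LINT t|lborel. character (- w) t * g t)"
    using fourier_AE_cong[OF f g(2,3)] fourier_lborel[of g] g(1) by (auto simp: fun_eq_iff)
  have "(\<lambda>n. LINT t|lborel. character (- x n) t * g t) \<longlonglongrightarrow> (LINT t|lborel. character (- w) t * g t)"
    if "x \<longlonglongrightarrow> w" for x w
  proof (rule integral_dominated_convergence[where w="\<lambda>t. norm (g t)"])
    show "AE t in lborel. (\<lambda>n. character (- x n) t * g t) \<longlonglongrightarrow> character (- w) t * g t"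
      unfolding character_def by (intro AE_I2 tendsto_intros that)
    show "(\<lambda>t. character (- x n) t * g t) \<in> borel_measurable lborel" for n
      using g(1) by measurable
    show "(\<lambda>t. character (- w) t * g t) \<in> borel_measurable lborel" using g(1) by measurable
  qed (use g(1) in \<open>auto simp: norm_mult\<close>)
  then show ?thesis unfolding eq continuous_on_sequentially by (auto simp: comp_def)
qed

lemma closed_spectrum_mod: "closed (spectrum_mod J A \<phi>)"
proof -
  have "spectrum_mod J A \<phi>
      = (\<Inter>f\<in>{f. integrable lebesgue f \<and> restrict (conv \<phi> f) J \<in> A}. {w. fourier f w = 0})"
    by (auto simp: spectrum_mod_def)
  also have "closed \<dots>"
    by (intro closed_INT ballI closed_Collect_eq continuous_on_fourier continuous_on_const) simp
  finally show ?thesis .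
qed

section \<open>Translation-invariant operators and classes of functions\<close>

locale L1_translation_operator =
  fixes T :: "(real \<Rightarrow> complex) \<Rightarrow> real \<Rightarrow> 'a::complex_banach" and C :: real
  assumes T_add_cmult: "integrable lborel f \<Longrightarrow> integrable lborel g \<Longrightarrow>
      T (\<lambda>s. f s + c * g s) t = T f t + c *\<^sub>C T g t"
    and T_bound: "integrable lborel f \<Longrightarrow> norm (T f t) \<le> C * L1_norm f"
    and T_translate: "integrable lborel f \<Longrightarrow> T (\<lambda>s. f (s + a)) t = T f (t + a)"
begin

lemma T_zero: "T (\<lambda>s. 0) t = 0"
  using T_bound[of "\<lambda>s. 0" t] by (simp add: L1_norm_def)

lemma T_add: "integrable lborel f \<Longrightarrow> integrable lborel g \<Longrightarrow> T (\<lambda>s. f s + g s) t = T f t + T g t"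
  using T_add_cmult[of f g 1] by simp

lemma T_cmult: "integrable lborel f \<Longrightarrow> T (\<lambda>s. c * f s) t = c *\<^sub>C T f t"
  using T_add_cmult[of "\<lambda>s. 0" f c] by (simp add: T_zero)

lemma T_diff:
  assumes "integrable lborel f" "integrable lborel g"
  shows "T (\<lambda>s. f s - g s) t = T f t - T g t"
  using T_add_cmult[OF assms, of "-1"] scaleC_of_real[of "-1" "T g t"] by simp

text \<open>
  Translating \<open>T f\<close> is applying \<open>T\<close> to a translate of \<open>f\<close>, so the modulus of continuity is inherited from \<open>L\<^sup>1\<close>.
\<close>
lemma T_Cub:
  assumes f: "integrable lborel f"
  shows "T f \<in> Cub"
  unfolding Cub_def
proof (intro CollectI conjI)
  show "bounded (range (T f))"
    using T_bound[OF f] by (auto simp: bounded_iff)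
  have "((\<lambda>a. C * L1_norm (\<lambda>x. f (x + a) - f x)) \<longlongrightarrow> C * 0) (at 0)"
    by (intro tendsto_mult_left L1_translation_continuous f)
  then have lim: "((\<lambda>a. C * L1_norm (\<lambda>x. f (x + a) - f x)) \<longlongrightarrow> 0) (at 0)" by simp
  show "uniformly_continuous_on UNIV (T f)"
    unfolding uniformly_continuous_on_def
  proof (intro allI impI)
    fix e :: real assume "0 < e"
    from order_tendstoD(2)[OF lim this]
    obtain d where d: "d > 0" "\<And>a. a \<noteq> 0 \<Longrightarrow> \<bar>a\<bar> < d \<Longrightarrow> C * L1_norm (\<lambda>x. f (x + a) - f x) < e"
      unfolding eventually_at by (auto simp: dist_real_def)
    have "dist (T f t') (T f t) < e" if "dist t' t < d" for t t'
    proof (cases "t' = t")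
      case False
      define a where "a = t' - t"
      have "dist (T f t') (T f t) = norm (T (\<lambda>s. f (s + a) - f s) t)"
        using T_translate[OF f, of a t] by (simp add: a_def dist_norm T_diff[OF integrable_translate[OF f] f])
      also have "\<dots> \<le> C * L1_norm (\<lambda>s. f (s + a) - f s)"
        by (intro T_bound Bochner_Integration.integrable_diff integrable_translate f)
      also have "\<dots> < e" using False that by (intro d) (auto simp: a_def dist_real_def)
      finally show ?thesis .
    qed (use \<open>0 < e\<close> in simp)
    then show "\<exists>d>0. \<forall>x\<in>UNIV. \<forall>x'\<in>UNIV. dist x' x < d \<longrightarrow> dist (T f x') (T f x) < e"
      using d(1) by blast
  qed
qed

text \<open>
  \<open>L\<^sup>1\<close> approximation becomes uniform approximation under \<open>T\<close>, and by \<open>T_Cub\<close> the invariance under translations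
  applies to every \<open>T f\<close>.
\<close>
lemma class_preimage_closed_ideal:
  assumes lin: "linear_on_fun J A" and uc: "uniformly_closed J A" and inv: "Cub_invariant J A"
  shows "L1_closed_ideal {f. integrable lborel f \<and> restrict (T f) J \<in> A}"
proof (unfold_locales, goal_cases)
  \<comment> \<open>The cases are integrability, the zero function, sums, multiples, limits and translates.\<close>
  case 2
  have "T (\<lambda>s. 0) = (\<lambda>t. 0)" by (simp add: fun_eq_iff T_zero)
  then show ?case using lin by (simp add: linear_on_fun_def)
next
  case (3 f g)
  then have "(\<lambda>t\<in>J. restrict (T f) J t + restrict (T g) J t) \<in> A"
    using lin unfolding linear_on_fun_def by blast
  also have "(\<lambda>t\<in>J. restrict (T f) J t + restrict (T g) J t) = restrict (T (\<lambda>s. f s + g s)) J"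
    using 3 by (auto simp: fun_eq_iff T_add)
  finally have "restrict (T (\<lambda>s. f s + g s)) J \<in> A" .
  then show ?case using 3 by simp
next
  case (4 f c)
  then have "(\<lambda>t\<in>J. c *\<^sub>C restrict (T f) J t) \<in> A"
    using lin unfolding linear_on_fun_def by blast
  also have "(\<lambda>t\<in>J. c *\<^sub>C restrict (T f) J t) = restrict (T (\<lambda>s. c * f s)) J"
    using 4 by (auto simp: fun_eq_iff T_cmult)
  finally have "restrict (T (\<lambda>s. c * f s)) J \<in> A" .
  then show ?case using 4 by simp
next
  case (5 f)
  have "\<exists>g. (integrable lborel g \<and> restrict (T g) J \<in> A) \<and> L1_norm (\<lambda>x. f x - g x) < 1 / real (Suc n)" for n
    using 5(2)[of "1 / real (Suc n)"] by auto
  then obtain g where g: "\<And>n. integrable lborel (g n)" "\<And>n. restrict (T (g n)) J \<in> A"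
    "\<And>n. L1_norm (\<lambda>x. f x - g n x) < 1 / real (Suc n)" by metis
  have "uniform_limit J (\<lambda>n. restrict (T (g n)) J) (restrict (T f) J) sequentially"
    unfolding uniform_limit_iff
  proof (intro allI impI)
    fix e :: real assume e: "e > 0"
    have "(\<lambda>n. \<bar>C\<bar> * (1 / real (Suc n))) \<longlonglongrightarrow> \<bar>C\<bar> * 0"
      by (intro tendsto_intros LIMSEQ_Suc lim_1_over_n)
    then have "\<forall>\<^sub>F n in sequentially. \<bar>C\<bar> * (1 / real (Suc n)) < e"
      using e by (intro order_tendstoD(2)[where y="\<bar>C\<bar> * 0"]) simp_all
    then show "\<forall>\<^sub>F n in sequentially. \<forall>x\<in>J. dist (restrict (T (g n)) J x) (restrict (T f) J x) < e"
    proof eventually_elim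
      case (elim n)
      show ?case
      proof
        fix t assume t: "t \<in> J"
        have "dist (restrict (T (g n)) J t) (restrict (T f) J t) = norm (T (\<lambda>s. f s - g n s) t)"
          using t by (simp add: dist_norm norm_minus_commute T_diff[OF 5(1) g(1)])
        also have "\<dots> \<le> C * L1_norm (\<lambda>s. f s - g n s)"
          by (intro T_bound Bochner_Integration.integrable_diff 5(1) g(1))
        also have "\<dots> \<le> \<bar>C\<bar> * (1 / real (Suc n))"
          using g(3)[of n] by (intro mult_mono) auto
        finally show "dist (restrict (T (g n)) J t) (restrict (T f) J t) < e" using elim by simp
      qed
    qed
  qed
  then have "restrict (T f) J \<in> A"
    using uc[unfolded uniformly_closed_def, rule_format, of "\<lambda>n. restrict (T (g n)) J" "restrict (T f) J"]
      g(2) restrict_extensional by blast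
  then show ?case using 5(1) by simp
next
  case (6 f a)
  then have "(\<lambda>t\<in>J. T f (t + a)) \<in> A"
    using inv T_Cub unfolding Cub_invariant_def by auto
  moreover have "(\<lambda>t\<in>J. T f (t + a)) = restrict (T (\<lambda>s. f (s + a))) J"
    using 6 by (auto simp: fun_eq_iff T_translate)
  ultimately have "restrict (T (\<lambda>s. f (s + a))) J \<in> A" by simp
  then show ?case using 6 by (simp add: integrable_translate)
qed simp

end

text \<open>
  Convolution with \<open>\<gamma>\<^bsub>-w\<^esub> \<phi>\<close>, written without forming that function so that properties of \<open>conv \<phi>\<close> carry over.
\<close>
definition demodulated_conv ::
    "real \<Rightarrow> (real \<Rightarrow> 'a::complex_banach) \<Rightarrow> (real \<Rightarrow> complex) \<Rightarrow> real \<Rightarrow> 'a"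
  where "demodulated_conv w \<phi> f t = character (- w) t *\<^sub>C conv \<phi> (\<lambda>s. character w s * f s) t"

lemma integrable_lebesgue_if_lborel:
  "integrable lborel f \<Longrightarrow> integrable lebesgue f" for f :: "real \<Rightarrow> complex"
  using integrable_completion[of f lborel] by simp

lemma demodulated_conv_operator:
  fixes \<phi> :: "real \<Rightarrow> 'a::complex_banach"
  assumes phi: "strongly_measurable lebesgue \<phi>" "AE t in lebesgue. norm (\<phi> t) \<le> C"
  shows "L1_translation_operator (demodulated_conv w \<phi>) C"
proof
  have ci: "integrable lebesgue (\<lambda>s. character w s * f s)" if "integrable lborel f" for f
    by (intro integrable_lebesgue_if_lborel integrable_character_mult that)
  fix f g :: "real \<Rightarrow> complex" and c :: complex and t a :: real
  assume f: "integrable lborel f"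
  show "norm (demodulated_conv w \<phi> f t) \<le> C * L1_norm f"
    using conv_integrand(2)[OF phi ci[OF f], of t] f
    by (simp add: demodulated_conv_def norm_scaleC norm_mult L1_norm_def integral_completion)
  show "demodulated_conv w \<phi> (\<lambda>s. f (s + a)) t = demodulated_conv w \<phi> f (t + a)"
  proof -
    have "conv \<phi> (\<lambda>s. character w s * f (s + a)) t
        = conv \<phi> (\<lambda>s. 0) t + character w (- a) *\<^sub>C conv \<phi> (\<lambda>s. character w (s + a) * f (s + a)) t"
    proof (rule conv_add_cmult[OF phi])
      show "integrable lebesgue (\<lambda>s. character w s * f (s + a))"
        by (intro ci integrable_translate f)
      show "integrable lebesgue (\<lambda>s. character w (s + a) * f (s + a))"
        by (intro integrable_lebesgue_if_lborel
            integrable_translate[where f="\<lambda>s. character w s * f s"] integrable_character_mult f)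
      show "AE s in lebesgue. character w s * f (s + a) = 0 + character w (- a) * (character w (s + a) * f (s + a))"
        by (intro AE_I2) (simp flip: mult.assoc character_add)
    qed simp
    also have "conv \<phi> (\<lambda>s. 0) t = 0"
      using conv_integrand(2)[OF phi, of "\<lambda>s. 0" t] by simp
    also have "conv \<phi> (\<lambda>s. character w (s + a) * f (s + a)) t = conv \<phi> (\<lambda>s. character w s * f s) (t + a)"
      by (rule conv_translate[OF phi ci[OF f]])
    finally have "demodulated_conv w \<phi> (\<lambda>s. f (s + a)) t
        = (character (- w) t * character w (- a)) *\<^sub>C conv \<phi> (\<lambda>s. character w s * f s) (t + a)"
      by (simp add: demodulated_conv_def scaleC_scaleC)
    also have "character (- w) t * character w (- a) = character (- w) (t + a)"
      by (simp add: character_add) (simp add: character_def)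
    finally show ?thesis by (simp add: demodulated_conv_def)
  qed
  assume g: "integrable lborel g"
  have "conv \<phi> (\<lambda>s. character w s * (f s + c * g s)) t
      = conv \<phi> (\<lambda>s. character w s * f s) t + c *\<^sub>C conv \<phi> (\<lambda>s. character w s * g s) t"
    by (rule conv_add_cmult[OF phi ci[OF f] ci[OF g] ci]) (use f g in \<open>auto simp: algebra_simps\<close>)
  then show "demodulated_conv w \<phi> (\<lambda>s. f s + c * g s) t
      = demodulated_conv w \<phi> f t + c *\<^sub>C demodulated_conv w \<phi> g t"
    by (simp add: demodulated_conv_def scaleC_add_right scaleC_scaleC mult.commute)
qed

text \<open>
  The forward mean integrates over \<open>t + s\<close>, a convolution over \<open>t - s\<close>; the reflection sends \<open>[0, h]\<close> to \<open>[-h, 0]\<close>.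
\<close>
lemma steklov_mean_demodulated:
  fixes \<phi> :: "real \<Rightarrow> 'a::complex_banach"
  assumes phi: "strongly_measurable lebesgue \<phi>" "AE t in lebesgue. norm (\<phi> t) \<le> C"
    and up: "\<And>s. 0 \<le> s \<Longrightarrow> s \<le> h \<Longrightarrow> t + s \<in> J"
  shows "steklov_mean h (\<lambda>t\<in>J. character (- w) t *\<^sub>C \<phi> t) t
    = (1 / h) *\<^sub>R demodulated_conv w \<phi> (indicator {-h..0}) t"
proof -
  let ?f = "\<lambda>s. character w s * indicator {-h..0} s"
  let ?g = "\<lambda>s. (\<lambda>t\<in>J. character (- w) t *\<^sub>C \<phi> t) (t + s)"
  have fi: "integrable lebesgue ?f"
    by (intro integrable_lebesgue_if_lborel integrable_character_mult integrable_indicator_Icc_complex)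
  have r: "has_bint lebesgue (\<lambda>s. ?f (- s) *\<^sub>C \<phi> (t + s)) (conv \<phi> ?f t)"
    using has_bint_reflection[OF _ conv_integrand(1)[OF phi fi, of t], of "-1" 0] by simp
  have eq: "(indicator {0..h} s :: complex) *\<^sub>C ?g s
      = 0 + character (- w) t *\<^sub>C (?f (- s) *\<^sub>C \<phi> (t + s))" for s
  proof (cases "s \<in> {0..h}")
    case True
    have "character (- w) (t + s) = character (- w) t * character w (- s)"
      by (simp add: character_add) (simp add: character_def)
    then show ?thesis using True up[of s] by (simp add: scaleC_scaleC)
  qed (auto simp: indicator_def scaleC.zero_left scaleC.zero_right)
  have "has_bint lebesgue (\<lambda>s. (indicator {0..h} s :: complex) *\<^sub>C ?g s) (0 + character (- w) t *\<^sub>C conv \<phi> ?f t)"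
  proof (rule has_bint_add_scaleC[OF has_bint_zero r])
    have "(\<lambda>s. ?f (- s) *\<^sub>C \<phi> (t + s)) \<in> borel_measurable lebesgue" using r by (simp add: has_bint_def)
    then show "(\<lambda>s. (indicator {0..h} s :: complex) *\<^sub>C ?g s) \<in> borel_measurable lebesgue"
      unfolding eq add_0_left
      by (rule borel_measurable_continuous_compose) (rule linear_continuous_on[OF scaleC.bounded_linear_right])
    show "AE s in lebesgue. (indicator {0..h} s :: complex) *\<^sub>C ?g s = 0 + character (- w) t *\<^sub>C (?f (- s) *\<^sub>C \<phi> (t + s))"
      by (intro AE_I2 eq)
  qed
  then have "has_bint (lebesgue_on {0..h}) ?g (0 + character (- w) t *\<^sub>C conv \<phi> ?f t)"
    by (intro has_bint_restrict_space) auto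
  then show ?thesis
    by (simp add: steklov_mean_def bint_eqI demodulated_conv_def)
qed

section \<open>Isolated points of the spectrum\<close>

lemma admissible_interval_upward_closed:
  "admissible_interval J \<Longrightarrow> t \<in> J \<Longrightarrow> 0 \<le> s \<Longrightarrow> t + s \<in> J"
  by (auto simp: admissible_interval_def)

text \<open>
  Indicators of intervals with right end point \<open>0\<close> belong to the preimage of \<open>U\<close> by hypothesis, translation gives
  all intervals, and density gives everything.
\<close>
lemma demodulated_conv_mem_if_steklov_means_mem:
  fixes \<phi> :: "real \<Rightarrow> 'a::complex_banach"
  assumes phi: "strongly_measurable lebesgue \<phi>" "AE t in lebesgue. norm (\<phi> t) \<le> C"
    and J: "admissible_interval J"
    and U: "linear_on_fun J U" "uniformly_closed J U" "Cub_invariant J U"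
    and mean: "(\<lambda>t\<in>J. character (- w) t *\<^sub>C \<phi> t) \<in> mean_class J U"
    and f: "integrable lborel f"
  shows "restrict (demodulated_conv w \<phi> f) J \<in> U"
proof -
  interpret T: L1_translation_operator "demodulated_conv w \<phi>" C
    by (rule demodulated_conv_operator[OF phi])
  interpret D: L1_closed_ideal "{f. integrable lborel f \<and> restrict (demodulated_conv w \<phi> f) J \<in> U}"
    by (rule T.class_preimage_closed_ideal[OF U])
  let ?D = "{f. integrable lborel f \<and> restrict (demodulated_conv w \<phi> f) J \<in> U}"
  have left: "indicator {-h..0} \<in> ?D" if h: "h > 0" for h
  proof -
    have "restrict (steklov_mean h (\<lambda>t\<in>J. character (- w) t *\<^sub>C \<phi> t)) J \<in> U"
      using mean h by (simp add: mean_class_def)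
    then have "(\<lambda>t\<in>J. of_real h *\<^sub>C restrict (steklov_mean h (\<lambda>t\<in>J. character (- w) t *\<^sub>C \<phi> t)) J t) \<in> U"
      using U(1) unfolding linear_on_fun_def by blast
    also have "(\<lambda>t\<in>J. of_real h *\<^sub>C restrict (steklov_mean h (\<lambda>t\<in>J. character (- w) t *\<^sub>C \<phi> t)) J t)
        = restrict (demodulated_conv w \<phi> (indicator {-h..0})) J"
    proof (rule restrict_ext)
      fix t assume t: "t \<in> J"
      have "steklov_mean h (\<lambda>t\<in>J. character (- w) t *\<^sub>C \<phi> t) t
          = (1 / h) *\<^sub>R demodulated_conv w \<phi> (indicator {-h..0}) t"
        by (rule steklov_mean_demodulated[OF phi admissible_interval_upward_closed[OF J t]])
      then show "of_real h *\<^sub>C restrict (steklov_mean h (\<lambda>t\<in>J. character (- w) t *\<^sub>C \<phi> t)) J t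
          = demodulated_conv w \<phi> (indicator {-h..0}) t"
        using t h by (simp add: scaleC_of_real)
    qed
    finally show ?thesis using integrable_indicator_Icc_complex by blast
  qed
  have "f \<in> ?D"
  proof (rule D.everything_if_interval_indicators[OF _ f])
    fix a b :: real assume ab: "a \<le> b"
    show "indicator {a..b} \<in> ?D"
    proof (cases "a = b")
      case True
      show ?thesis
        by (rule D.AE_mem[OF D.zero_mem])
          (auto simp: True indicator_def intro!: AE_mp[OF AE_lborel_singleton[of b] AE_I2])
    next
      case False
      then have "indicator {-(b - a)..0} \<in> ?D" using ab by (intro left) simp
      from D.translate_mem[OF this, of "- b"]
      show ?thesis by (rule back_subst[where P="\<lambda>f. f \<in> ?D"]) (auto simp: indicator_def)
    qed
  qed
  then show ?thesis by simp
qed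

theorem proposition9p5:
  fixes J :: "real set"
    and A U :: "(real \<Rightarrow> 'a::complex_banach) set"
    and \<phi> :: "real \<Rightarrow> 'a"
  assumes "admissible_interval J"
    and "A \<subseteq> L1loc J" and "linear_on_fun J A" and "uniformly_closed J A" and "Cub_invariant J A"
    and "U \<subseteq> L1loc J" and "linear_on_fun J U" and "uniformly_closed J U" and "Cub_invariant J U"
    and "cond_L J U A"
    and "\<phi> \<in> Linf"
    and "\<And>\<omega>. \<omega> \<in> spectrum_mod J A \<phi> \<Longrightarrow> (\<lambda>f. \<lambda>t\<in>J. character \<omega> t *\<^sub>C f t) ` A \<subseteq> A"
    and "\<And>\<omega>. \<omega> \<in> spectrum_mod J A \<phi> \<Longrightarrow> (\<lambda>f. \<lambda>t\<in>J. character (- \<omega>) t *\<^sub>C f t) ` A \<subseteq> A"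
    and "\<And>\<omega>. \<omega> \<in> spectrum_mod J A \<phi> \<Longrightarrow>
           (\<lambda>t\<in>J. character (- \<omega>) t *\<^sub>C \<phi> t) \<in> mean_class J U"
  shows "closed (spectrum_mod J A \<phi>) \<and> \<not> (\<exists>\<omega>. \<omega> isolated_in spectrum_mod J A \<phi>)"
proof (intro conjI notI)
  show "closed (spectrum_mod J A \<phi>)" by (rule closed_spectrum_mod)
next
  assume "\<exists>\<omega>. \<omega> isolated_in spectrum_mod J A \<phi>"
  then obtain w S where w: "w \<in> spectrum_mod J A \<phi>" and S: "open S" "S \<inter> spectrum_mod J A \<phi> = {w}"
    by (auto simp: isolated_in_def)
  note J = assms(1) and A = assms(3,4,5) and U = assms(7,8,9)
  obtain C where phi: "strongly_measurable lebesgue \<phi>" "AE t in lebesgue. norm (\<phi> t) \<le> C"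
    using assms(11) by (auto simp: Linf_def)
  define T where "T = demodulated_conv w \<phi>"
  interpret T: L1_translation_operator T C
    unfolding T_def by (rule demodulated_conv_operator[OF phi])
  define D where "D = {f. integrable lborel f \<and> restrict (T f) J \<in> A}"
  interpret D: L1_closed_ideal D
    unfolding D_def by (rule T.class_preimage_closed_ideal[OF A])
  have "w \<in> S" using S by auto
  then obtain e where e: "e > 0" "ball w e \<subseteq> S" using S(1) openE by blast
  define a where "a = e / 2"
  have a: "a > 0" using e by (simp add: a_def)
  have hull: "\<exists>g\<in>D. fourier g u \<noteq> 0" if u: "u \<noteq> 0" "\<bar>u\<bar> \<le> a" for u
  proof -
    have "w + u \<in> S" using u e by (auto intro!: subsetD[OF e(2)] simp: dist_real_def a_def)
    then have "w + u \<notin> spectrum_mod J A \<phi>" using S(2) u(1) add_cancel_left_right[of w u] by blast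
    then obtain f where f: "integrable lebesgue f" "restrict (conv \<phi> f) J \<in> A" "fourier f (w + u) \<noteq> 0"
      by (auto simp: spectrum_mod_def)
    obtain f' where f': "integrable lborel f'" "integrable lebesgue f'" "AE x in lebesgue. f x = f' x"
      by (rule integrable_lebesgue_borel_version[OF f(1)])
    have "AE x in lebesgue. f' x = f x + 0 * f x" using f'(3) by eventually_elim simp
    from conv_add_cmult[OF phi f(1) f(1) f'(2) this]
    have conv: "conv \<phi> f' t = conv \<phi> f t" for t by (simp add: scaleC.zero_left)
    define g where "g s = character (- w) s * f' s" for s
    have gi: "integrable lborel g"
      unfolding g_def[abs_def] by (rule integrable_character_mult[OF f'(1)])
    have "character w s * g s = f' s" for s
      using character_minus_mult[of "- w" s] by (simp add: g_def flip: mult.assoc)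
    then have Tg: "T g t = character (- w) t *\<^sub>C conv \<phi> f t" for t
      by (simp add: T_def demodulated_conv_def conv)
    have "(\<lambda>t\<in>J. character (- w) t *\<^sub>C restrict (conv \<phi> f) J t) \<in> A"
      using assms(13)[OF w] f(2) by blast
    also have "(\<lambda>t\<in>J. character (- w) t *\<^sub>C restrict (conv \<phi> f) J t) = restrict (T g) J"
      by (auto simp: fun_eq_iff Tg)
    finally have "restrict (T g) J \<in> A" .
    then have "g \<in> D" using gi by (simp add: D_def)
    moreover have "fourier g u = fourier f (w + u)"
    proof -
      have "character (- u) s * g s = character (- (w + u)) s * f' s" for s
        using character_add_freq[of "- u" "- w" s] by (simp add: g_def algebra_simps)
      then have "fourier g u = fourier f' (w + u)"
        using gi f'(1) by (simp add: fourier_lborel)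
      then show ?thesis using fourier_AE_cong[OF f(1) f'(2,3)] by simp
    qed
    ultimately show ?thesis using f(3) by metis
  qed
  \<comment> \<open>The function to which \<open>cond_L\<close> is applied is the restriction of \<open>T k\<close>.\<close>
  define k where "k = tent_kernel 0 a"
  have k: "integrable lborel k" unfolding k_def by (rule integrable_tent_kernel[OF a])
  have Uk: "restrict (T k) J \<in> U"
    unfolding T_def
    by (rule demodulated_conv_mem_if_steklov_means_mem[OF phi J U assms(14)[OF w] k])
  have "(\<lambda>t\<in>J. restrict (T k) J (t + h) - restrict (T k) J t) \<in> A" if "h > 0" for h
  proof -
    have "(\<lambda>t. k (t + h) - k t) \<in> D"
      unfolding k_def by (rule D.difference_tent_kernel_mem[OF a hull])
    then have "restrict (T (\<lambda>t. k (t + h) - k t)) J \<in> A" by (simp add: D_def)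
    also have "restrict (T (\<lambda>t. k (t + h) - k t)) J = (\<lambda>t\<in>J. restrict (T k) J (t + h) - restrict (T k) J t)"
      using admissible_interval_upward_closed[OF J, of _ h] that
      by (auto simp: fun_eq_iff T.T_diff[OF integrable_translate[OF k] k] T.T_translate[OF k])
    finally show ?thesis .
  qed
  then have Ak: "restrict (T k) J \<in> A"
    using assms(10) Uk unfolding cond_L_def by blast
  define f where "f s = character w s * k s" for s
  have fi: "integrable lborel f"
    unfolding f_def[abs_def] by (rule integrable_character_mult[OF k])
  have "(\<lambda>t\<in>J. character w t *\<^sub>C restrict (T k) J t) \<in> A"
    using assms(12)[OF w] Ak by blast
  also have "(\<lambda>t\<in>J. character w t *\<^sub>C restrict (T k) J t) = restrict (conv \<phi> f) J"
  proof (rule restrict_ext)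
    fix t assume "t \<in> J"
    then show "character w t *\<^sub>C restrict (T k) J t = conv \<phi> f t"
      using character_minus_mult[of "- w" t]
      by (simp add: T_def demodulated_conv_def scaleC_scaleC f_def[abs_def])
  qed
  finally have "restrict (conv \<phi> f) J \<in> A" .
  then have "fourier f w = 0"
    using w integrable_lebesgue_if_lborel[OF fi] by (simp add: spectrum_mod_def)
  moreover have "character (- w) s * f s = k s" for s
    by (simp add: f_def flip: mult.assoc)
  ultimately show False
    using integral_tent_kernel_0[OF a] fi by (simp add: fourier_lborel k_def)
qed

end
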